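(* Let $p$ be an odd prime, let $T$ be the regular $p$-adic rooted tree, and let $G\le\operatorname{Aut}(T)$ be a multi-edge spinal group that is not $\operatorname{Aut}(T)$-conjugate to the group $\mathcal{G}=\langle a,b\rangle$, where $b$ is defined recursively by $\psi_1(b)=(a,a,\ldots,a,b)$. Then $G$ is a branch group.
   Context: Let $p$ be an odd prime and $X=\{1,\ldots,p\}$. The regular $p$-adic rooted tree $T$ has as vertices the finite words over $X$, with root the empty word and an edge from $v$ to $vx$ for each word $v$ and each $x\in X$. $\operatorname{Aut}(T)$ is the group of automorphisms of the rooted tree $T$, acting on the right. For a vertex $u$, the full subtree $T_u$ of words with prefix $u$ is identified with $T$ by deleting the prefix $u$. The section of $f\in\operatorname{Aut}(T)$ at $u$ is the automorphism $f_u$ of $T$ with $(uv)^f=u^f v^{f_u}$ for all words $v$. $\operatorname{Stab}_{\operatorname{Aut}(T)}(1)$ is the subgroup fixing all vertices of length $1$, and $\psi_1\colon \operatorname{Stab}_{\operatorname{Aut}(T)}(1)\to \operatorname{Aut}(T)\times\overset{p}{\ldots}\times\operatorname{Aut}(T)$ is the isomorphism $f\mapsto(f_1,\ldots,f_p)$, where $f_x$ is the section at the vertex $x\in X$. Let $a$ be the rooted automorphism corresponding to the $p$-cycle $(1\,2\,\ldots\,p)$, i.e. $(xv)^a=x^{(1\,2\,\ldots\,p)}v$ for $x\in X$ and words $v$. Given $r\ge 1$ and an $r$-tuple $\mathbf{E}$ of $(\mathbb{Z}/p\mathbb{Z})$-linearly independent vectors $\mathbf{e}_i=(e_{i,1},\ldots,e_{i,p-1})\in(\mathbb{Z}/p\mathbb{Z})^{p-1}$,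 $i\in\{1,\ldots,r\}$, define recursively $b_1,\ldots,b_r\in\operatorname{Stab}_{\operatorname{Aut}(T)}(1)$ by $\psi_1(b_i)=(a^{e_{i,1}},\ldots,a^{e_{i,p-1}},b_i)$. The multi-edge spinal group associated to $\mathbf{E}$ is $G_{\mathbf{E}}=\langle a,b_1,\ldots,b_r\rangle\le\operatorname{Aut}(T)$. Branch groups: for a sequence $\overline{m}=(m_n)_{n\ge1}$ of integers $m_n\ge2$, the spherically homogeneous rooted tree $T_{\overline{m}}$ is the infinite rooted tree in which every vertex of level $n-1$ has out-degree $m_n$. For such a tree, $\operatorname{Stab}(n)$ denotes the subgroup of its automorphism group fixing all vertices of level $n$, and $T_n$ denotes the full subtree rooted at a level $n$ vertex (all such subtrees being naturally identified), so that $\operatorname{Stab}(n)$ is naturally the direct product of $N_n=\prod_{i=1}^n m_i$ copies of $\operatorname{Aut}(T_n)$, one for each vertex of level $n$. A group $G$ is a branch group if there is a spherically homogeneous rooted tree $T_{\overline{m}}$ and an embedding $G\hookrightarrow\operatorname{Aut}(T_{\overline{m}})$ such that (1) $G$ acts transitively on each layer of the tree; (2) for each level $n$ there is a subgroup $L_n\le\operatorname{Aut}(T_n)$ such that the direct product $H_n=L_n^{(1)}\times\cdots\times L_n^{(N_n)}\le\operatorname{Stab}(n)$ of $N_n$ copies of $L_n$ (one at each level $n$ vertex) is contained in $G$ as a normal subgroup of finite index. *)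

theory Defs
  imports "HOL-Algebra.Generated_Groups" "HOL-Combinatorics.Permutations" "HOL-Number_Theory.Cong"
begin

text \<open>A sequence \<open>m\<close> (only the values \<open>m 1, m 2, \<dots>\<close> matter) gives the spherically homogeneous
  rooted tree in which a vertex of level \<open>n\<close> is a word \<open>x\<^sub>1\<dots>x\<^sub>n\<close> with \<open>x\<^sub>i \<in> {1..m i}\<close>, so that
  every vertex of level \<open>n - 1\<close> has \<open>m n\<close> children.  The regular \<open>p\<close>-adic tree is \<open>m = (\<lambda>_. p)\<close>.\<close>

definition vertices :: "(nat \<Rightarrow> nat) \<Rightarrow> nat list set" where
  "vertices m = {w. \<forall>i<length w. w ! i \<in> {1..m (Suc i)}}"

definition level :: "(nat \<Rightarrow> nat) \<Rightarrow> nat \<Rightarrow> nat list set" where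
  "level m n = {w \<in> vertices m. length w = n}"

definition tree_edge :: "nat list \<Rightarrow> nat list \<Rightarrow> bool" where
  "tree_edge u v \<longleftrightarrow> (\<exists>x. v = u @ [x])"

text \<open>The sequence of out-degrees of the full subtrees rooted at level \<open>n\<close>.\<close>

definition subtree :: "nat \<Rightarrow> (nat \<Rightarrow> nat) \<Rightarrow> (nat \<Rightarrow> nat)" where
  "subtree n m = (\<lambda>i. m (n + i))"

text \<open>Automorphisms are represented by functions on all of \<^typ>\<open>nat list\<close> that are the identity
  off the vertex set (this is part of \<open>permutes\<close>), so equality of automorphisms is equality of
  functions.  The group acts on the right: in \<open>f \<otimes> g\<close> the factor \<open>f\<close> is applied first.\<close>

definition tree_auts :: "(nat \<Rightarrow> nat) \<Rightarrow> (nat list \<Rightarrow> nat list) set" where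
  "tree_auts m = {f. f permutes vertices m \<and> f [] = [] \<and>
     (\<forall>u\<in>vertices m. \<forall>v\<in>vertices m. tree_edge (f u) (f v) \<longleftrightarrow> tree_edge u v)}"

definition AutT :: "(nat \<Rightarrow> nat) \<Rightarrow> (nat list \<Rightarrow> nat list) monoid" where
  "AutT m = \<lparr>carrier = tree_auts m, monoid.mult = (\<lambda>f g. g \<circ> f), one = id\<rparr>"

definition level_stab :: "(nat \<Rightarrow> nat) \<Rightarrow> nat \<Rightarrow> (nat list \<Rightarrow> nat list) set" where
  "level_stab m n = {f \<in> carrier (AutT m). \<forall>u\<in>level m n. f u = u}"

text \<open>The section \<open>f\<^sub>u\<close> is determined by \<open>f (u @ v) = f u @ f\<^sub>u v\<close>, where \<open>f u\<close> has the same length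
  as \<open>u\<close>; see \<open>sect_append\<close> below.\<close>

definition sect :: "(nat list \<Rightarrow> nat list) \<Rightarrow> nat list \<Rightarrow> (nat list \<Rightarrow> nat list)" where
  "sect f u = (\<lambda>v. drop (length u) (f (u @ v)))"

text \<open>\<open>level_product m n L\<close> is the direct product of copies of \<open>L\<close>, one at each vertex of level \<open>n\<close>,
  as a subset of the stabiliser of that level.\<close>

definition level_product ::
    "(nat \<Rightarrow> nat) \<Rightarrow> nat \<Rightarrow> (nat list \<Rightarrow> nat list) set \<Rightarrow> (nat list \<Rightarrow> nat list) set" where
  "level_product m n L = {f \<in> level_stab m n. \<forall>u\<in>level m n. sect f u \<in> L}"

definition branch_group :: "('g, 'h) monoid_scheme \<Rightarrow> bool" where
  "branch_group G \<longleftrightarrow> group G \<and>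
     (\<exists>m \<phi>. (\<forall>n\<ge>1. 2 \<le> m n) \<and>
        \<phi> \<in> hom G (AutT m) \<and> inj_on \<phi> (carrier G) \<and>
        (\<forall>n. \<forall>u\<in>level m n. \<forall>v\<in>level m n. \<exists>g\<in>carrier G. \<phi> g u = v) \<and>
        (\<forall>n. \<exists>L. subgroup L (AutT (subtree n m)) \<and>
           level_product m n L \<lhd> (AutT m)\<lparr>carrier := \<phi> ` carrier G\<rparr> \<and>
           finite (rcosets\<^bsub>(AutT m)\<lparr>carrier := \<phi> ` carrier G\<rparr>\<^esub> level_product m n L)))"

definition conjugate_in :: "('g, 'h) monoid_scheme \<Rightarrow> 'g set \<Rightarrow> 'g set \<Rightarrow> bool" where
  "conjugate_in A H K \<longleftrightarrow>
     (\<exists>g\<in>carrier A. K = (\<lambda>h. inv\<^bsub>A\<^esub> g \<otimes>\<^bsub>A\<^esub> h \<otimes>\<^bsub>A\<^esub> g) ` H)"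

abbreviation RegAut :: "nat \<Rightarrow> (nat list \<Rightarrow> nat list) monoid" where
  "RegAut p \<equiv> AutT (\<lambda>_. p)"

definition rooted_a :: "nat \<Rightarrow> nat list \<Rightarrow> nat list" where
  "rooted_a p w = (if w \<in> vertices (\<lambda>_. p) then
     (case w of [] \<Rightarrow> [] | x # v \<Rightarrow> (if x = p then 1 else x + 1) # v) else w)"

text \<open>The automorphism with sections \<open>a^(e 1), \<dots>, a^(e (p - 1))\<close> and itself at the vertices of
  level one (see \<open>spinal_b_in_stab\<close>, \<open>sect_spinal_b\<close> and \<open>spinal_b_unique\<close> below).  Vectors over
  \<open>\<int>/p\<int>\<close> are given by integer representatives \<open>e 1, \<dots>, e (p - 1)\<close> of their entries.\<close>

primrec spinal_b :: "nat \<Rightarrow> (nat \<Rightarrow> int) \<Rightarrow> nat list \<Rightarrow> nat list" where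
  "spinal_b p e [] = []"
| "spinal_b p e (x # v) = x # (if x = p then spinal_b p e v
     else if x \<in> {1..p - 1} then (rooted_a p [^]\<^bsub>RegAut p\<^esub> e x) v else v)"

definition indep_mod :: "nat \<Rightarrow> nat \<Rightarrow> (nat \<Rightarrow> nat \<Rightarrow> int) \<Rightarrow> bool" where
  "indep_mod p r E \<longleftrightarrow>
     (\<forall>c :: nat \<Rightarrow> int. (\<forall>j\<in>{1..p - 1}. [(\<Sum>i = 1..r. c i * E i j) = 0] (mod int p)) \<longrightarrow>
        (\<forall>i\<in>{1..r}. [c i = 0] (mod int p)))"

definition multi_edge_spinal :: "nat \<Rightarrow> (nat list \<Rightarrow> nat list) set \<Rightarrow> bool" where
  "multi_edge_spinal p G \<longleftrightarrow>
     (\<exists>r E. 1 \<le> r \<and> indep_mod p r E \<and>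
        G = generate (RegAut p) (insert (rooted_a p) ((\<lambda>i. spinal_b p (E i)) ` {1..r})))"

text \<open>The group \<open>\<langle>a, b\<rangle>\<close> with \<open>\<psi>\<^sub>1 b = (a, \<dots>, a, b)\<close>.\<close>

definition exceptional_group :: "nat \<Rightarrow> (nat list \<Rightarrow> nat list) set" where
  "exceptional_group p = generate (RegAut p) {rooted_a p, spinal_b p (\<lambda>_. 1)}"

subsection \<open>Sanity lemmas\<close>

lemma Nil_in_vertices [simp]: "[] \<in> vertices m"
  by (simp add: vertices_def)

lemma Cons_in_vertices [simp]:
  "x # v \<in> vertices m \<longleftrightarrow> x \<in> {1..m 1} \<and> v \<in> vertices (subtree 1 m)"
  unfolding vertices_def subtree_def by (simp add: All_less_Suc2)

lemma append_in_vertices: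
  "u @ v \<in> vertices m \<longleftrightarrow> u \<in> vertices m \<and> v \<in> vertices (subtree (length u) m)"
proof (induction u arbitrary: m)
  case Nil
  then show ?case by (simp add: subtree_def)
next
  case (Cons x u)
  have "subtree (length u) (subtree 1 m) = subtree (length (x # u)) m"
    by (simp add: subtree_def add_ac)
  then show ?case using Cons by simp
qed

lemma subtree_const [simp]: "subtree n (\<lambda>_. p) = (\<lambda>_. p)"
  by (simp add: subtree_def)

lemma tree_auts_snoc:
  assumes "f \<in> tree_auts m" "u @ [x] \<in> vertices m"
  obtains y where "f (u @ [x]) = f u @ [y]"
proof -
  have "u \<in> vertices m" using assms(2) by (simp add: append_in_vertices)
  moreover have "tree_edge u (u @ [x])" by (simp add: tree_edge_def)
  ultimately have "tree_edge (f u) (f (u @ [x]))"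
    using assms by (auto simp: tree_auts_def)
  then show thesis using that by (auto simp: tree_edge_def)
qed

lemma tree_auts_length:
  assumes f: "f \<in> tree_auts m"
  shows "length (f w) = length w"
proof (cases "w \<in> vertices m")
  case True
  then show ?thesis
  proof (induction w rule: rev_induct)
    case Nil
    then show ?case using f by (simp add: tree_auts_def)
  next
    case (snoc x u)
    then show ?case using tree_auts_snoc [OF f snoc.prems]
      by (metis append_in_vertices length_append_singleton)
  qed
next
  case False
  then show ?thesis using f by (auto simp: tree_auts_def permutes_def)
qed

lemma sect_append:
  assumes f: "f \<in> tree_auts m" and "u @ v \<in> vertices m"
  shows "f (u @ v) = f u @ sect f u v"
  using assms(2)
proof (induction v rule: rev_induct)
  case Nil
  then show ?case using tree_auts_length [OF f, of u] by (simp add: sect_def)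
next
  case (snoc x v)
  then have "u @ v \<in> vertices m"
    by (metis append_assoc append_in_vertices)
  then have IH: "f (u @ v) = f u @ sect f u v" using snoc by blast
  obtain y where "f ((u @ v) @ [x]) = f (u @ v) @ [y]"
    using tree_auts_snoc [OF f, of "u @ v" x] snoc.prems by auto
  then have eq: "f (u @ v @ [x]) = f u @ sect f u v @ [y]" using IH by simp
  have "sect f u (v @ [x]) = drop (length u) (f (u @ v @ [x]))" by (simp add: sect_def)
  then show ?case using eq tree_auts_length [OF f, of u] by simp
qed

lemma carrier_AutT: "carrier (AutT m) = tree_auts m"
  by (simp add: AutT_def)

lemma group_AutT: "group (AutT m)"
proof (rule groupI)
  fix f g assume "f \<in> carrier (AutT m)" "g \<in> carrier (AutT m)"
  then have fg: "f \<in> tree_auts m" "g \<in> tree_auts m" by (auto simp: AutT_def)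
  then have "f u \<in> vertices m" if "u \<in> vertices m" for u
    using that permutes_in_image [of f "vertices m"] by (auto simp: tree_auts_def)
  then show "f \<otimes>\<^bsub>AutT m\<^esub> g \<in> carrier (AutT m)"
    using fg by (auto simp: AutT_def tree_auts_def intro!: permutes_compose)
next
  fix f assume "f \<in> carrier (AutT m)"
  then have f: "f \<in> tree_auts m" by (simp add: AutT_def)
  then have p: "f permutes vertices m" by (simp add: tree_auts_def)
  have im: "inv_into UNIV f u \<in> vertices m" if "u \<in> vertices m" for u
    using that permutes_in_image [OF permutes_inv [OF p]] by auto
  have "inv_into UNIV f \<in> tree_auts m"
    unfolding tree_auts_def
  proof (intro CollectI conjI ballI)
    show "inv_into UNIV f permutes vertices m" by (rule permutes_inv [OF p])
    show "inv_into UNIV f [] = []" using f permutes_inv_eq [OF p] by (auto simp: tree_auts_def)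
    fix u v assume "u \<in> vertices m" "v \<in> vertices m"
    then have "tree_edge (f (inv_into UNIV f u)) (f (inv_into UNIV f v)) =
        tree_edge (inv_into UNIV f u) (inv_into UNIV f v)"
      using f im [of u] im [of v] unfolding tree_auts_def by blast
    then show "tree_edge (inv_into UNIV f u) (inv_into UNIV f v) = tree_edge u v"
      by (simp only: permutes_inverses (1) [OF p])
  qed
  then show "\<exists>g\<in>carrier (AutT m). g \<otimes>\<^bsub>AutT m\<^esub> f = \<one>\<^bsub>AutT m\<^esub>"
    using permutes_inv_o (1) [OF p] by (auto simp: AutT_def)
qed (auto simp: AutT_def tree_auts_def permutes_id)

lemma tree_autsI:
  assumes V: "\<And>w. w \<in> vertices m \<Longrightarrow> f w \<in> vertices m" "\<And>w. w \<notin> vertices m \<Longrightarrow> f w = w"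
    and inj: "inj_on f (vertices m)"
    and len: "\<And>w. w \<in> vertices m \<Longrightarrow> length (f w) = length w"
    and snoc: "\<And>u x. u @ [x] \<in> vertices m \<Longrightarrow> \<exists>y. f (u @ [x]) = f u @ [y]"
  shows "f \<in> tree_auts m"
proof -
  have lev: "f ` level m n = level m n" for n
  proof (rule endo_inj_surj)
    have "level m n \<subseteq> {w. set w \<subseteq> {..Max (m ` {..n})} \<and> length w = n}"
    proof (clarsimp simp: level_def vertices_def in_set_conv_nth)
      fix w :: "nat list" and i
      assume "\<forall>i<length w. Suc 0 \<le> w ! i \<and> w ! i \<le> m (Suc i)" "i < length w"
      then have "w ! i \<le> m (Suc i)" "Suc i \<in> {..length w}" by auto
      then show "w ! i \<le> Max (m ` {..length w})"
        by (meson Max_ge finite_atMost finite_imageI image_eqI le_trans)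
    qed
    then show "finite (level m n)"
      by (rule finite_subset) (rule finite_lists_length_eq, simp)
    show "f ` level m n \<subseteq> level m n" using V(1) len by (auto simp: level_def)
    show "inj_on f (level m n)" using inj by (rule inj_on_subset) (auto simp: level_def)
  qed
  have "f ` vertices m = vertices m"
  proof
    show "f ` vertices m \<subseteq> vertices m" using V(1) by auto
    show "vertices m \<subseteq> f ` vertices m"
    proof
      fix w assume "w \<in> vertices m"
      then have "w \<in> f ` level m (length w)" unfolding lev by (simp add: level_def)
      then show "w \<in> f ` vertices m" by (auto simp: level_def)
    qed
  qed
  then have perm: "f permutes vertices m"
    using inj V(2) by (intro bij_imp_permutes) (auto simp: bij_betw_def)
  have "tree_edge (f u) (f v) \<longleftrightarrow> tree_edge u v"
    if u: "u \<in> vertices m" and v: "v \<in> vertices m" for u v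
  proof
    assume "tree_edge u v"
    then show "tree_edge (f u) (f v)" using snoc v by (auto simp: tree_edge_def)
  next
    assume "tree_edge (f u) (f v)"
    then obtain y where y: "f v = f u @ [y]" by (auto simp: tree_edge_def)
    then have "length v = Suc (length u)" using len [OF u] len [OF v] by simp
    then obtain u' x where v': "v = u' @ [x]" by (metis Zero_not_Suc list.size(3) rev_exhaust)
    then obtain z where "f v = f u' @ [z]" using snoc v by blast
    then have "f u' = f u" using y by simp
    moreover have "u' \<in> vertices m" using v v' by (simp add: append_in_vertices)
    ultimately have "u' = u" using inj u by (auto dest: inj_onD)
    then show "tree_edge u v" using v' by (simp add: tree_edge_def)
  qed
  then show ?thesis using perm len [of "[]"] by (simp add: tree_auts_def)
qed

lemma rooted_a_in_AutT: "rooted_a p \<in> carrier (RegAut p)"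
proof -
  let ?V = "vertices (\<lambda>_. p)"
  define s where "s x = (if x = p then 1 else x + 1)" for x
  have nil: "rooted_a p [] = []" by (simp add: rooted_a_def)
  have step: "rooted_a p (x # v) = s x # v" if "x # v \<in> ?V" for x v
    using that unfolding rooted_a_def s_def by (simp only: if_True list.case)
  have s_X: "s x \<in> {1..p}" if "x \<in> {1..p}" for x using that by (simp add: s_def)
  have s_inj: "x = y" if "s x = s y" "x \<in> {1..p}" "y \<in> {1..p}" for x y
    using that unfolding s_def atLeastAtMost_iff by presburger
  have "rooted_a p \<in> tree_auts (\<lambda>_. p)"
  proof (rule tree_autsI)
    fix w assume w: "w \<in> ?V"
    show "rooted_a p w \<in> ?V" using w s_X by (cases w) (auto simp only: nil step Cons_in_vertices)
    show "length (rooted_a p w) = length w" using w by (cases w) (simp_all only: nil step list.size)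
  next
    show "rooted_a p w = w" if "w \<notin> ?V" for w using that by (simp add: rooted_a_def)
    show "inj_on (rooted_a p) ?V"
    proof (rule inj_onI)
      fix w w' assume *: "w \<in> ?V" "w' \<in> ?V" "rooted_a p w = rooted_a p w'"
      show "w = w'"
      proof (cases w)
        case Nil
        then show ?thesis using * by (cases w') (simp_all only: nil step list.distinct)
      next
        case (Cons x v)
        then show ?thesis using *
        proof (cases w')
          case Nil
          then show ?thesis using * Cons by (simp only: nil step list.distinct)
        next
          case (Cons y v')
          then have "s x = s y" "v = v'" using * \<open>w = x # v\<close> by (simp_all only: step list.inject)
          then show ?thesis using * s_inj Cons \<open>w = x # v\<close> by simp
        qed
      qed
    qed
    show "\<exists>y. rooted_a p (u @ [x]) = rooted_a p u @ [y]" if w: "u @ [x] \<in> ?V" for u x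
    proof (cases u)
      case Nil
      then show ?thesis using w by (simp only: append_Nil nil step) blast
    next
      case (Cons z v)
      then have "z # v \<in> ?V" using w by (simp add: append_in_vertices)
      then show ?thesis using w Cons by (simp only: append_Cons step) blast
    qed
  qed
  then show ?thesis by (simp add: AutT_def)
qed

lemma rooted_a_pow_in_tree_auts: "rooted_a p [^]\<^bsub>RegAut p\<^esub> (k :: int) \<in> tree_auts (\<lambda>_. p)"
  using group.int_pow_closed [OF group_AutT rooted_a_in_AutT] by (simp add: AutT_def)

lemma spinal_b_in_stab:
  assumes p: "1 \<le> p"
  shows "spinal_b p e \<in> level_stab (\<lambda>_. p) 1"
proof -
  let ?V = "vertices (\<lambda>_. p)"
  define A where "A k = rooted_a p [^]\<^bsub>RegAut p\<^esub> (k :: int)" for k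
  have A: "A k \<in> tree_auts (\<lambda>_. p)" for k
    using rooted_a_pow_in_tree_auts by (simp add: A_def)
  have Ap: "A k permutes ?V" "A k [] = []" for k using A by (auto simp: tree_auts_def)
  have step: "spinal_b p e (x # v) = x # (if x = p then spinal_b p e v
     else if x \<in> {1..p - 1} then A (e x) v else v)" for x v by (simp add: A_def)
  have "spinal_b p e \<in> tree_auts (\<lambda>_. p)"
  proof (rule tree_autsI)
    fix w
    show "spinal_b p e w \<in> ?V" if "w \<in> ?V"
      using that p by (induction w) (auto simp: step permutes_in_image [OF Ap(1)] simp del: spinal_b.simps(2))
    show "spinal_b p e w = w" if "w \<notin> ?V"
      using that p by (induction w) (auto simp: step permutes_not_in [OF Ap(1)] simp del: spinal_b.simps(2))
    show "length (spinal_b p e w) = length w"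
      by (induction w) (auto simp: step tree_auts_length [OF A] simp del: spinal_b.simps(2))
    fix u x
    show "\<exists>y. spinal_b p e (u @ [x]) = spinal_b p e u @ [y]" if "u @ [x] \<in> ?V"
      using that
    proof (induction u)
      case Nil
      then show ?case using Ap by (simp add: step del: spinal_b.simps(2))
    next
      case (Cons z u)
      then have "u @ [x] \<in> ?V" by simp
      then show ?case using Cons.IH tree_auts_snoc [OF A, of u x]
        by (auto simp: step simp del: spinal_b.simps(2))
    qed
  next
    have "w = w'" if "spinal_b p e w = spinal_b p e w'" for w w'
      using that
    proof (induction w arbitrary: w')
      case Nil
      then show ?case by (cases w') auto
    next
      case (Cons x w)
      then show ?case using permutes_inj [OF Ap(1)]
        by (cases w') (auto simp: A_def split: if_splits dest: injD)
    qed
    then show "inj_on (spinal_b p e) ?V" by (auto intro: inj_onI)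
  qed
  then show ?thesis
    by (auto simp: level_stab_def carrier_AutT level_def length_Suc_conv Ap(2) step
        simp del: spinal_b.simps(2))
qed

lemma sect_spinal_b:
  "x \<in> {1..p - 1} \<Longrightarrow> sect (spinal_b p e) [x] = rooted_a p [^]\<^bsub>RegAut p\<^esub> e x"
  "sect (spinal_b p e) [p] = spinal_b p e"
  by (auto simp: sect_def fun_eq_iff)

lemma spinal_b_unique:
  assumes p: "1 \<le> p" and b: "b \<in> level_stab (\<lambda>_. p) 1"
    and "\<And>x. x \<in> {1..p - 1} \<Longrightarrow> sect b [x] = rooted_a p [^]\<^bsub>RegAut p\<^esub> e x"
    and "sect b [p] = b"
  shows "b = spinal_b p e"
proof
  fix w
  have auts: "b \<in> tree_auts (\<lambda>_. p)" "spinal_b p e \<in> tree_auts (\<lambda>_. p)"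
    using b spinal_b_in_stab [OF p, of e] by (auto simp: level_stab_def AutT_def)
  show "b w = spinal_b p e w"
  proof (cases "w \<in> vertices (\<lambda>_. p)")
    case True
    then show ?thesis
    proof (induction w)
      case Nil
      then show ?case using auts by (simp add: tree_auts_def)
    next
      case (Cons x w)
      then have x: "x \<in> {1..p}" by simp
      have "b [x] = [x]" using b x by (auto simp: level_stab_def level_def)
      then have *: "b (x # w) = x # sect b [x] w"
        using sect_append [OF auts(1), of "[x]" w] Cons.prems by simp
      show ?case
      proof (cases "x = p")
        case True
        then show ?thesis using * Cons assms(4) by simp
      next
        case False
        then show ?thesis using * assms(3) [of x] x by auto
      qed
    qed
  next
    case False
    then show ?thesis using auts by (auto simp: tree_auts_def permutes_def)
  qed
qed

end

theory Submission imports Defs "HOL-Number_Theory.Residues" begin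

text \<open>Write \<open>\<delta> g\<close> for the automorphism acting as \<open>g\<close> on the subtree at the vertex \<open>p\<close> and trivially
  elsewhere.  It suffices to find a normal subgroup \<open>K\<close> of finite index in \<open>G\<close> with \<open>\<delta> K \<subseteq> K\<close>: then the
  product of copies of \<open>K\<close> at the vertices of any level lies in \<open>K\<close>.  Since the stabilizer of level one
  projects onto \<open>G\<close> at every vertex, \<open>M = {g \<in> G. \<delta> g \<in> K}\<close> is normal in \<open>G\<close>, so \<open>K \<subseteq> M\<close> needs to
  be checked on few elements only.  The commutator of \<open>b\<^sub>v\<close> with the conjugate of \<open>b\<^sub>w\<close> by \<open>a ^ l\<close> has
  the section \<open>[b\<^sub>v, a ^ w (p - l)]\<close> at \<open>p\<close>, the section \<open>[a ^ v l, b\<^sub>w]\<close> at \<open>l\<close>, and no others.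

  If \<open>r \<ge> 2\<close>, take for \<open>K\<close> the derived subgroup: the vectors \<open>v\<close> with \<open>v l = 0\<close> yield \<open>[b\<^sub>v, a] \<in> M\<close>, and
  if this failed for some generator, all coordinate functionals on the span of \<open>E\<close> would vanish on
  a common hyperplane, against independence.  If \<open>r = 1\<close>, take for \<open>K\<close> the third term of the lower
  central series.  Commuting once more with elements of the stabilizer that are trivial at \<open>l\<close> shows
  that \<open>b ^ e (l + j)\<close> and \<open>a ^ (e l * e j)\<close> agree modulo the centralizer \<open>Z\<close> of the commutators modulo
  \<open>M\<close>.  Either this gives \<open>Z = G\<close>, or \<open>e\<close> satisfies \<open>e l * e j = s * e (l + j)\<close>; in the latter case
  \<open>e\<close> is constant and \<open>G\<close> is the exceptional group.\<close>

section \<open>Commutators and relative normality\<close>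

context group
begin

definition comm :: "'a \<Rightarrow> 'a \<Rightarrow> 'a" where
  "comm x y = inv x \<otimes> inv y \<otimes> x \<otimes> y"

text \<open>Phrased inside the ambient group, so that inverses and products need no transfer to the
  group structure on \<open>H\<close>; \<open>normal_of_normal_in\<close> translates at the
  end.\<close>

definition normal_in :: "'a set \<Rightarrow> 'a set \<Rightarrow> bool" where
  "normal_in N H \<longleftrightarrow> subgroup N G \<and> N \<subseteq> H \<and> (\<forall>h\<in>H. \<forall>n\<in>N. inv h \<otimes> n \<otimes> h \<in> N)"

text \<open>If \<open>R\<close> is not contained in \<open>H\<close>, the family is empty and the
  intersection is \<open>UNIV\<close>; hence the assumption \<open>R \<subseteq> H\<close> in
  \<open>normal_in_normal_hull\<close>.\<close>

definition normal_hull :: "'a set \<Rightarrow> 'a set \<Rightarrow> 'a set" where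
  "normal_hull H R = \<Inter>{N. normal_in N H \<and> R \<subseteq> N}"

text \<open>Finite index in a form where \<open>X\<close> need not be a group and the
  representatives come from the ambient group.\<close>

definition finite_cover :: "'a set \<Rightarrow> 'a set \<Rightarrow> bool" where
  "finite_cover N X \<longleftrightarrow>
     (\<exists>F. finite F \<and> F \<subseteq> carrier G \<and> (\<forall>x\<in>X. \<exists>n\<in>N. \<exists>t\<in>F. x = n \<otimes> t))"

lemma inv_mult_cancel [simp]:
  assumes "x \<in> carrier G" "y \<in> carrier G"
  shows "inv x \<otimes> (x \<otimes> y) = y" "x \<otimes> (inv x \<otimes> y) = y"
  using assms by (simp_all add: m_assoc [symmetric])

lemma comm_closed [simp, intro]:
  "x \<in> carrier G \<Longrightarrow> y \<in> carrier G \<Longrightarrow> comm x y \<in> carrier G"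
  by (simp add: comm_def)

lemma comm_one [simp]:
  assumes "x \<in> carrier G" shows "comm x \<one> = \<one>" "comm \<one> x = \<one>"
  using assms by (simp_all add: comm_def)

lemma comm_eq_one:
  assumes "x \<in> carrier G" "y \<in> carrier G" "x \<otimes> y = y \<otimes> x"
  shows "comm x y = \<one>"
proof -
  have "comm x y = inv x \<otimes> (inv y \<otimes> (x \<otimes> y))" using assms(1,2) by (simp add: comm_def m_assoc)
  then show ?thesis using assms(1,2) by (simp add: assms(3))
qed

lemma comm_self [simp]: "x \<in> carrier G \<Longrightarrow> comm x x = \<one>"
  by (rule comm_eq_one) auto

lemma comm_swap:
  "x \<in> carrier G \<Longrightarrow> y \<in> carrier G \<Longrightarrow> comm y x = inv (comm x y)"
  by (simp add: comm_def m_assoc inv_mult_group)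

lemma comm_mult_right:
  "x \<in> carrier G \<Longrightarrow> y \<in> carrier G \<Longrightarrow> z \<in> carrier G \<Longrightarrow>
   comm x (y \<otimes> z) = comm x z \<otimes> (inv z \<otimes> comm x y \<otimes> z)"
  by (simp add: comm_def m_assoc inv_mult_group)

lemma comm_inv_right:
  "x \<in> carrier G \<Longrightarrow> y \<in> carrier G \<Longrightarrow>
   comm x (inv y) = inv (inv y) \<otimes> inv (comm x y) \<otimes> inv y"
  by (simp add: comm_def m_assoc inv_mult_group)

lemma conj_comm:
  "x \<in> carrier G \<Longrightarrow> y \<in> carrier G \<Longrightarrow> u \<in> carrier G \<Longrightarrow>
   inv u \<otimes> comm x y \<otimes> u = comm (inv u \<otimes> x \<otimes> u) (inv u \<otimes> y \<otimes> u)"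
  by (simp add: comm_def m_assoc inv_mult_group)

lemma comm_conj_right:
  "x \<in> carrier G \<Longrightarrow> y \<in> carrier G \<Longrightarrow> u \<in> carrier G \<Longrightarrow>
   comm x (inv u \<otimes> y \<otimes> u) = inv u \<otimes> comm (inv (inv u) \<otimes> x \<otimes> inv u) y \<otimes> u"
  by (simp add: comm_def m_assoc inv_mult_group)

lemma mult_comm_right:
  "x \<in> carrier G \<Longrightarrow> y \<in> carrier G \<Longrightarrow> inv y \<otimes> x \<otimes> y = x \<otimes> comm x y"
  by (simp add: comm_def m_assoc inv_mult_group)

section \<open>Normality inside a subgroup, and centralizers modulo a normal subgroup\<close>

lemma normal_inD:
  assumes "normal_in N H"
  shows "subgroup N G" "N \<subseteq> H" "h \<in> H \<Longrightarrow> n \<in> N \<Longrightarrow> inv h \<otimes> n \<otimes> h \<in> N"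
  using assms by (auto simp: normal_in_def)

lemma normal_in_self: "subgroup H G \<Longrightarrow> normal_in H H"
  by (auto simp: normal_in_def subgroup.m_inv_closed subgroup.m_closed)

lemma normal_in_conj':
  assumes "normal_in N H" "subgroup H G" "h \<in> H" "n \<in> N"
  shows "h \<otimes> n \<otimes> inv h \<in> N"
  using normal_inD(3) [OF assms(1) subgroup.m_inv_closed [OF assms(2,3)] assms(4)]
    subgroup.mem_carrier [OF assms(2,3)] by simp

lemma comm_sym_mem:
  assumes "subgroup N G" "x \<in> carrier G" "y \<in> carrier G"
  shows "comm y x \<in> N \<longleftrightarrow> comm x y \<in> N"
  using subgroup.m_inv_closed [OF assms(1)] assms by (metis comm_swap)

text \<open>Closure comes from \<open>[y, g h] = [y, h] [y, g]^h\<close> and the invariance of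
  \<open>N\<close> under \<open>H\<close>. As \<open>y\<close> may be any group element, membership
  of commutators can be checked on generators.\<close>

lemma subgroup_centralizing:
  assumes N: "normal_in N H" and H: "subgroup H G" and y: "y \<in> carrier G"
  shows "subgroup {g \<in> H. comm y g \<in> N} G"
proof (rule subgroupI)
  note N1 = normal_inD(1) [OF N] and Hc = subgroup.mem_carrier [OF H]
  show "{g \<in> H. comm y g \<in> N} \<subseteq> carrier G" using Hc by auto
  show "{g \<in> H. comm y g \<in> N} \<noteq> {}"
    using y subgroup.one_closed [OF H] subgroup.one_closed [OF N1] by auto
next
  note N1 = normal_inD(1) [OF N] and Hc = subgroup.mem_carrier [OF H]
  fix g assume "g \<in> {g \<in> H. comm y g \<in> N}"
  then have g: "g \<in> H" "comm y g \<in> N" by auto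
  have "comm y (inv g) \<in> N"
    using comm_inv_right [OF y Hc [OF g(1)]]
      normal_inD(3) [OF N subgroup.m_inv_closed [OF H g(1)] subgroup.m_inv_closed [OF N1 g(2)]]
    by simp
  then show "inv g \<in> {g \<in> H. comm y g \<in> N}" using subgroup.m_inv_closed [OF H g(1)] by simp
next
  note N1 = normal_inD(1) [OF N] and Hc = subgroup.mem_carrier [OF H]
  fix g h assume "g \<in> {g \<in> H. comm y g \<in> N}" "h \<in> {g \<in> H. comm y g \<in> N}"
  then have g: "g \<in> H" "comm y g \<in> N" and h: "h \<in> H" "comm y h \<in> N" by auto
  have "comm y (g \<otimes> h) \<in> N"
    unfolding comm_mult_right [OF y Hc [OF g(1)] Hc [OF h(1)]]
    by (intro subgroup.m_closed [OF N1] normal_inD(3) [OF N] g h)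
  then show "g \<otimes> h \<in> {g \<in> H. comm y g \<in> N}" using subgroup.m_closed [OF H g(1) h(1)] by simp
qed

text \<open>\<open>[y, u^-1 g u]\<close> is the conjugate by \<open>u\<close> of
  \<open>[u y u^-1, g]\<close>, and \<open>u y u^-1\<close> is again in \<open>Y\<close>.\<close>

lemma normal_in_centralizing:
  assumes N: "normal_in N H" and H: "subgroup H G" and Y: "Y \<subseteq> carrier G"
    and conj: "\<And>y u. y \<in> Y \<Longrightarrow> u \<in> H \<Longrightarrow> inv u \<otimes> y \<otimes> u \<in> Y"
  shows "normal_in {g \<in> H. \<forall>y\<in>Y. comm y g \<in> N} H" (is "normal_in ?Z H")
proof -
  note Hc = subgroup.mem_carrier [OF H]
  have sub: "subgroup {g \<in> H. comm y g \<in> N} G" if "y \<in> Y" for y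
    using that Y by (intro subgroup_centralizing [OF N H]) auto
  have "subgroup ?Z G"
  proof (rule subgroupI)
    show "?Z \<subseteq> carrier G" using Hc by auto
    have "comm y \<one> \<in> N" if "y \<in> Y" for y using subgroup.one_closed [OF sub [OF that]] by simp
    then show "?Z \<noteq> {}" using subgroup.one_closed [OF H] by auto
    show "inv g \<in> ?Z" if "g \<in> ?Z" for g
      using that subgroup.m_inv_closed [OF sub, of _ g] subgroup.m_inv_closed [OF H] by auto
    show "g \<otimes> h \<in> ?Z" if "g \<in> ?Z" "h \<in> ?Z" for g h
      using that subgroup.m_closed [OF sub, of _ g h] subgroup.m_closed [OF H] by auto
  qed
  moreover have "inv u \<otimes> g \<otimes> u \<in> ?Z" if u: "u \<in> H" and g: "g \<in> ?Z" for u g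
  proof -
    have "comm y (inv u \<otimes> g \<otimes> u) \<in> N" if "y \<in> Y" for y
    proof -
      have "inv (inv u) \<otimes> y \<otimes> inv u \<in> Y" using conj [OF that subgroup.m_inv_closed [OF H u]] .
      then have "comm (inv (inv u) \<otimes> y \<otimes> inv u) g \<in> N" using g by auto
      then show ?thesis
        using comm_conj_right [of y g u] that Y Hc u g normal_inD(3) [OF N u] by auto
    qed
    moreover have "inv u \<otimes> g \<otimes> u \<in> H"
      using u g by (auto intro!: subgroup.m_closed [OF H] subgroup.m_inv_closed [OF H])
    ultimately show ?thesis by blast
  qed
  ultimately show ?thesis by (auto simp: normal_in_def)
qed

lemma generate_subset_subgroup:
  assumes "subgroup K G" "S \<subseteq> K" "x \<in> generate G S"
  shows "x \<in> K"
  using generate_subgroup_incl [OF assms(2,1)] assms(3) by auto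

text \<open>The elements commuting with a fixed one modulo \<open>N\<close> form a subgroup; this is
  used first for a generator, then for an arbitrary \<open>y\<close>.\<close>

lemma comm_mem_of_generators:
  assumes S: "S \<subseteq> carrier G" and N: "normal_in N (generate G S)"
    and gen: "\<And>s t. s \<in> S \<Longrightarrow> t \<in> S \<Longrightarrow> comm s t \<in> N"
    and x: "x \<in> generate G S" and y: "y \<in> generate G S"
  shows "comm x y \<in> N"
proof -
  let ?H = "generate G S"
  note N1 = normal_inD(1) [OF N] and H = generate_is_subgroup [OF S]
  note Hc = subgroup.mem_carrier [OF H]
  have SH: "S \<subseteq> ?H" by (auto intro: generate.incl)
  have 1: "comm s y \<in> N" if s: "s \<in> S" and y: "y \<in> ?H" for s y
    using generate_subset_subgroup [OF subgroup_centralizing [OF N H], of s S y] gen s y S SH by auto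
  have "S \<subseteq> {g \<in> ?H. comm y g \<in> N}"
    using 1 y SH S Hc comm_sym_mem [OF N1] by blast
  then have "comm y x \<in> N"
    using generate_subset_subgroup [OF subgroup_centralizing [OF N H], of y S x] y x Hc by auto
  then show ?thesis using comm_sym_mem [OF N1] x y Hc by auto
qed

lemma comm_generator_mem:
  assumes S: "S \<subseteq> carrier G" and N: "normal_in N (generate G S)"
    and gen: "\<And>s. s \<in> S \<Longrightarrow> comm c s \<in> N"
    and c: "c \<in> carrier G" and y: "y \<in> generate G S"
  shows "comm c y \<in> N"
  using generate_subset_subgroup [OF subgroup_centralizing [OF N generate_is_subgroup [OF S] c], of S y]
    gen y by (auto intro: generate.incl)

text \<open>\<open>?Z\<close> is the preimage of the centre of \<open>H/N\<close>. Commutators of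
  generators lie in it, hence all commutators do, by \<open>comm_mem_of_generators\<close> modulo
  \<open>?Z\<close>.\<close>

lemma triple_comm_mem_of_generators:
  assumes S: "S \<subseteq> carrier G" and N: "normal_in N (generate G S)"
    and gen: "\<And>s t u. s \<in> S \<Longrightarrow> t \<in> S \<Longrightarrow> u \<in> S \<Longrightarrow> comm (comm s t) u \<in> N"
    and xyz: "x \<in> generate G S" "y \<in> generate G S" "z \<in> generate G S"
  shows "comm (comm x y) z \<in> N"
proof -
  let ?H = "generate G S"
  let ?Z = "{g \<in> ?H. \<forall>y\<in>?H. comm y g \<in> N}"
  note N1 = normal_inD(1) [OF N] and H = generate_is_subgroup [OF S]
  note Hc = subgroup.mem_carrier [OF H]
  have Z: "normal_in ?Z ?H"
    using Hc by (intro normal_in_centralizing [OF N H])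
      (auto intro!: subgroup.m_closed [OF H] subgroup.m_inv_closed [OF H])
  have "comm s t \<in> ?Z" if st: "s \<in> S" "t \<in> S" for s t
  proof -
    have "s \<in> ?H" "t \<in> ?H" using st by (auto intro: generate.incl)
    then have "comm s t \<in> ?H"
      unfolding comm_def by (intro subgroup.m_closed [OF H] subgroup.m_inv_closed [OF H])
    moreover have "comm (comm s t) y \<in> N" if "y \<in> ?H" for y
    proof (rule comm_generator_mem [OF S N])
      show "comm (comm s t) u \<in> N" if "u \<in> S" for u using gen [OF st that] .
    qed (use st S \<open>y \<in> ?H\<close> in auto)
    moreover have "comm s t \<in> carrier G" using st S by auto
    ultimately show ?thesis using comm_sym_mem [OF N1] Hc by auto
  qed
  then have "comm x y \<in> ?Z" using comm_mem_of_generators [OF S Z] xyz(1,2) by blast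
  then have "comm z (comm x y) \<in> N" using xyz by auto
  then show ?thesis using comm_sym_mem [OF N1] xyz Hc by auto
qed

lemma normal_in_normal_hull:
  assumes H: "subgroup H G" and R: "R \<subseteq> H"
  shows "normal_in (normal_hull H R) H"
proof -
  have HH: "normal_in H H \<and> R \<subseteq> H" using normal_in_self [OF H] R by simp
  then have "H \<in> {N. normal_in N H \<and> R \<subseteq> N}" by simp
  then have "subgroup (normal_hull H R) G"
    unfolding normal_hull_def by (intro subgroups_Inter) (auto dest: normal_inD)
  then show ?thesis using HH by (auto simp: normal_in_def normal_hull_def)
qed

lemma normal_hull_superset: "R \<subseteq> normal_hull H R"
  by (auto simp: normal_hull_def)

lemma normal_hull_least: "normal_in N H \<Longrightarrow> R \<subseteq> N \<Longrightarrow> normal_hull H R \<subseteq> N"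
  by (auto simp: normal_hull_def)

lemma normal_in_pow_diff:
  assumes N: "normal_in N H" and H: "subgroup H G" and x: "x \<in> H" and z: "z \<in> H"
    and xz: "x \<otimes> inv z \<in> N"
  shows "x [^] (k :: int) \<otimes> inv (z [^] k) \<in> N"
proof -
  note N1 = normal_inD(1) [OF N]
  note c = subgroup.mem_carrier [OF H x] subgroup.mem_carrier [OF H z]
  have xn: "x [^] (n :: nat) \<in> H" for n
    using subgroup_int_pow_closed [OF H x, of "int n"] by (simp add: int_pow_int)
  have nat: "x [^] (n :: nat) \<otimes> inv (z [^] n) \<in> N" for n
  proof (induction n)
    case 0
    then show ?case using subgroup.one_closed [OF N1] by simp
  next
    case (Suc n)
    have "x [^] Suc n \<otimes> inv (z [^] Suc n) =
        (x [^] n \<otimes> (x \<otimes> inv z) \<otimes> inv (x [^] n)) \<otimes> (x [^] n \<otimes> inv (z [^] n))"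
      using c by (simp add: m_assoc inv_mult_group)
    also have "\<dots> \<in> N"
      by (intro subgroup.m_closed [OF N1] normal_in_conj' [OF N H xn xz] Suc)
    finally show ?case .
  qed
  show ?thesis
  proof (cases "k < 0")
    case True
    define n where "n = nat (- k)"
    have "inv (x [^] n) \<otimes> inv (x [^] n \<otimes> inv (z [^] n)) \<otimes> x [^] n \<in> N"
      by (intro normal_inD(3) [OF N xn] subgroup.m_inv_closed [OF N1] nat)
    moreover have "inv (x [^] n) \<otimes> inv (x [^] n \<otimes> inv (z [^] n)) \<otimes> x [^] n = inv (x [^] n) \<otimes> z [^] n"
      using c by (simp add: m_assoc inv_mult_group)
    ultimately show ?thesis using True c unfolding int_pow_def2 n_def by simp
  next
    case False
    then show ?thesis using nat [of "nat k"] by simp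
  qed
qed

section \<open>Products of subgroups and finite index\<close>

lemma subset_set_mult:
  assumes X: "subgroup X G" and Y: "subgroup Y G"
  shows "X \<subseteq> X <#> Y" "Y \<subseteq> X <#> Y"
proof -
  show "X \<subseteq> X <#> Y"
  proof
    fix x assume x: "x \<in> X"
    have "x \<otimes> \<one> \<in> X <#> Y"
      unfolding set_mult_def using x subgroup.one_closed [OF Y] by blast
    then show "x \<in> X <#> Y" using subgroup.mem_carrier [OF X x] by simp
  qed
  show "Y \<subseteq> X <#> Y"
  proof
    fix x assume x: "x \<in> Y"
    have "\<one> \<otimes> x \<in> X <#> Y"
      unfolding set_mult_def using x subgroup.one_closed [OF X] by blast
    then show "x \<in> X <#> Y" using subgroup.mem_carrier [OF Y x] by simp
  qed
qed

lemma subgroup_normal_set_mult: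
  assumes N: "normal_in N H" and H: "subgroup H G" and Q: "subgroup Q G" "Q \<subseteq> H"
  shows "subgroup (N <#> Q) G"
proof (rule subgroupI)
  note N1 = normal_inD(1) [OF N] and Hc = subgroup.mem_carrier [OF H]
  note Nc = subgroup.mem_carrier [OF N1] and Qc = subgroup.mem_carrier [OF Q(1)]
  show "N <#> Q \<subseteq> carrier G" using Nc Qc by (auto simp: set_mult_def)
  show "N <#> Q \<noteq> {}"
    using subgroup.one_closed [OF N1] subgroup.one_closed [OF Q(1)] by (auto simp: set_mult_def)
next
  note N1 = normal_inD(1) [OF N] and Hc = subgroup.mem_carrier [OF H]
  note Nc = subgroup.mem_carrier [OF N1] and Qc = subgroup.mem_carrier [OF Q(1)]
  fix x assume "x \<in> N <#> Q"
  then obtain n q where x: "n \<in> N" "q \<in> Q" "x = n \<otimes> q" by (auto simp: set_mult_def)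
  have "inv x = (inv q \<otimes> inv n \<otimes> q) \<otimes> inv q"
    using x Nc Qc by (simp add: m_assoc inv_mult_group)
  moreover have "inv q \<otimes> inv n \<otimes> q \<in> N"
    using x Q by (intro normal_inD(3) [OF N] subgroup.m_inv_closed [OF N1]) auto
  ultimately show "inv x \<in> N <#> Q"
    using subgroup.m_inv_closed [OF Q(1) x(2)] by (auto simp: set_mult_def)
next
  note N1 = normal_inD(1) [OF N] and Hc = subgroup.mem_carrier [OF H]
  note Nc = subgroup.mem_carrier [OF N1] and Qc = subgroup.mem_carrier [OF Q(1)]
  fix x y assume "x \<in> N <#> Q" "y \<in> N <#> Q"
  then obtain n q m r where x: "n \<in> N" "q \<in> Q" "x = n \<otimes> q" and y: "m \<in> N" "r \<in> Q" "y = m \<otimes> r"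
    by (auto simp: set_mult_def)
  have "x \<otimes> y = (n \<otimes> (q \<otimes> m \<otimes> inv q)) \<otimes> (q \<otimes> r)"
    using x y Nc Qc by (simp add: m_assoc)
  moreover have "n \<otimes> (q \<otimes> m \<otimes> inv q) \<in> N"
    using x y Q by (intro subgroup.m_closed [OF N1] normal_in_conj' [OF N H]) auto
  moreover have "q \<otimes> r \<in> Q" using x y by (intro subgroup.m_closed [OF Q(1)])
  ultimately show "x \<otimes> y \<in> N <#> Q" by (auto simp: set_mult_def)
qed

text \<open>Since \<open>q^h = q [q, h]\<close>, a \<open>Q\<close> that is central modulo
  \<open>N\<close> has a normal product with \<open>N\<close>.\<close>

lemma normal_in_set_mult:
  assumes N: "normal_in N H" and H: "subgroup H G" and Q: "subgroup Q G" "Q \<subseteq> H"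
    and central: "\<And>q h. q \<in> Q \<Longrightarrow> h \<in> H \<Longrightarrow> comm q h \<in> N"
  shows "normal_in (N <#> Q) H"
proof -
  note N1 = normal_inD(1) [OF N] and Hc = subgroup.mem_carrier [OF H]
  note Nc = subgroup.mem_carrier [OF N1] and Qc = subgroup.mem_carrier [OF Q(1)]
  have "N <#> Q \<subseteq> H"
    using normal_inD(2) [OF N] Q(2) by (auto simp: set_mult_def intro!: subgroup.m_closed [OF H])
  moreover have "inv h \<otimes> x \<otimes> h \<in> N <#> Q" if h: "h \<in> H" and "x \<in> N <#> Q" for h x
  proof -
    obtain n q where x: "n \<in> N" "q \<in> Q" "x = n \<otimes> q" using \<open>x \<in> N <#> Q\<close> by (auto simp: set_mult_def)
    have "inv h \<otimes> x \<otimes> h = (inv h \<otimes> n \<otimes> h) \<otimes> (q \<otimes> comm q h \<otimes> inv q) \<otimes> q"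
      using x Nc Qc Hc h by (simp add: m_assoc comm_def)
    moreover have "(inv h \<otimes> n \<otimes> h) \<otimes> (q \<otimes> comm q h \<otimes> inv q) \<in> N"
      using x h Q central
      by (intro subgroup.m_closed [OF N1] normal_in_conj' [OF N H] normal_inD(3) [OF N]) auto
    ultimately show ?thesis using x(2) by (auto simp: set_mult_def)
  qed
  ultimately show ?thesis using subgroup_normal_set_mult [OF N H Q] by (simp add: normal_in_def)
qed

lemma finite_cover_trans:
  assumes N: "subgroup N G" and Q: "Q \<subseteq> carrier G"
    and 1: "finite_cover N Q" and 2: "finite_cover (N <#> Q) X"
  shows "finite_cover N X"
proof -
  note Nc = subgroup.mem_carrier [OF N]
  obtain F1 where F1: "finite F1" "F1 \<subseteq> carrier G" "\<And>x. x \<in> Q \<Longrightarrow> \<exists>n\<in>N. \<exists>t\<in>F1. x = n \<otimes> t"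
    using 1 unfolding finite_cover_def by metis
  obtain F2 where F2: "finite F2" "F2 \<subseteq> carrier G" "\<And>x. x \<in> X \<Longrightarrow> \<exists>n\<in>N <#> Q. \<exists>t\<in>F2. x = n \<otimes> t"
    using 2 unfolding finite_cover_def by metis
  let ?F = "(\<lambda>(s, t). s \<otimes> t) ` (F1 \<times> F2)"
  have "\<exists>n\<in>N. \<exists>t\<in>?F. x = n \<otimes> t" if "x \<in> X" for x
  proof -
    obtain n q t where t: "n \<in> N" "q \<in> Q" "t \<in> F2" "x = n \<otimes> q \<otimes> t"
      using F2(3) [OF \<open>x \<in> X\<close>] unfolding set_mult_def by blast
    obtain n' s where s: "n' \<in> N" "s \<in> F1" "q = n' \<otimes> s" using F1(3) [OF t(2)] by blast
    have "x = (n \<otimes> n') \<otimes> (s \<otimes> t)"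
      using s t subsetD [OF F1(2)] subsetD [OF F2(2)] Nc by (simp add: m_assoc)
    moreover have "n \<otimes> n' \<in> N" using s t by (intro subgroup.m_closed [OF N])
    moreover have "s \<otimes> t \<in> ?F" using s t by (intro image_eqI [of _ _ "(s, t)"]) auto
    ultimately show ?thesis by blast
  qed
  moreover have "finite ?F" "?F \<subseteq> carrier G" using F1(1,2) F2(1,2) by auto
  ultimately show ?thesis unfolding finite_cover_def by (intro exI [of _ ?F]) simp
qed

lemma finite_cover_set_mult:
  assumes "subgroup N G" "finite Q" "Q \<subseteq> carrier G" "X \<subseteq> N <#> Q"
  shows "finite_cover N X"
proof -
  have "\<exists>n\<in>N. \<exists>t\<in>Q. x = n \<otimes> t" if "x \<in> X" for x
  proof -
    have "x \<in> N <#> Q" using that assms(4) by blast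
    then show ?thesis by (auto simp: set_mult_def)
  qed
  then show ?thesis using assms(2,3) unfolding finite_cover_def by (intro exI [of _ Q]) simp
qed

lemma finite_rcosets_of_cover:
  assumes N: "normal_in N H" and H: "subgroup H G" and "finite_cover N H"
  shows "finite (rcosets\<^bsub>G\<lparr>carrier := H\<rparr>\<^esub> N)"
proof -
  note Nc = subgroup.mem_carrier [OF normal_inD(1) [OF N]]
  obtain F where F: "finite F" "F \<subseteq> carrier G" "\<And>x. x \<in> H \<Longrightarrow> \<exists>n\<in>N. \<exists>t\<in>F. x = n \<otimes> t"
    using assms(3) unfolding finite_cover_def by metis
  have "rcosets\<^bsub>G\<lparr>carrier := H\<rparr>\<^esub> N \<subseteq> (\<lambda>t. N #> t) ` F"
  proof
    fix C assume "C \<in> rcosets\<^bsub>G\<lparr>carrier := H\<rparr>\<^esub> N"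
    then obtain h where h: "h \<in> H" "C = N #> h" by (auto simp: RCOSETS_def r_coset_def)
    obtain n t where t: "n \<in> N" "t \<in> F" "h = n \<otimes> t" using F(3) [OF h(1)] by auto
    have "N #> h = (N #> n) #> t"
      using t F(2) Nc by (subst coset_mult_assoc) auto
    also have "N #> n = N" using t(1) coset_join2 [OF _ normal_inD(1) [OF N]] Nc by auto
    finally show "C \<in> (\<lambda>t. N #> t) ` F" using h t by auto
  qed
  then show ?thesis using F(1) by (meson finite_imageI finite_subset)
qed

lemma normal_of_normal_in:
  assumes N: "normal_in N H" and H: "subgroup H G"
  shows "N \<lhd> G\<lparr>carrier := H\<rparr>"
proof -
  interpret HH: group "G\<lparr>carrier := H\<rparr>" using H by (rule subgroup_imp_group)
  have "subgroup N (G\<lparr>carrier := H\<rparr>)"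
    using normal_inD(1,2) [OF N] by (intro subgroup_incl H)
  moreover have "x \<otimes> n \<otimes> inv\<^bsub>G\<lparr>carrier := H\<rparr>\<^esub> x \<in> N" if "x \<in> H" "n \<in> N" for x n
    using normal_in_conj' [OF N H that] m_inv_consistent [OF H that(1)] by simp
  ultimately show ?thesis by (simp add: HH.normal_inv_iff)
qed

end

section \<open>Automorphisms of the regular tree as tuples\<close>

lemma tree_auts_fix: "f \<in> tree_auts m \<Longrightarrow> w \<notin> vertices m \<Longrightarrow> f w = w"
  by (auto simp: tree_auts_def permutes_def)

lemma tree_auts_Nil: "f \<in> tree_auts m \<Longrightarrow> f [] = []"
  by (simp add: tree_auts_def)

lemma tree_auts_in_vertices: "f \<in> tree_auts m \<Longrightarrow> f w \<in> vertices m \<longleftrightarrow> w \<in> vertices m"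
  by (auto simp: tree_auts_def permutes_in_image)

lemma tree_auts_inj: "f \<in> tree_auts m \<Longrightarrow> inj f"
  by (auto simp: tree_auts_def intro: permutes_inj)

section \<open>Indices modulo \<open>p\<close>\<close>

text \<open>Residues modulo \<open>p\<close> are represented in \<open>{1..p}\<close>, the labels of
  the first level; the class of 0 is represented by \<open>p\<close>, the vertex where
  \<open>spinal_b\<close> recurs.\<close>

definition wrap :: "nat \<Rightarrow> int \<Rightarrow> nat" where
  "wrap p j = nat ((j - 1) mod int p) + 1"

lemma wrap_range: "1 \<le> p \<Longrightarrow> wrap p j \<in> {1..p}"
  by (auto simp: wrap_def nat_less_iff Suc_le_eq)

lemma int_wrap: "1 \<le> p \<Longrightarrow> int (wrap p j) = (j - 1) mod int p + 1"
  by (simp add: wrap_def)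

lemma wrap_of_nat: "x \<in> {1..p} \<Longrightarrow> wrap p (int x) = x"
  by (auto simp: wrap_def nat_diff_distrib)

lemma cong_int_wrap: "1 \<le> p \<Longrightarrow> [int (wrap p j) = j] (mod int p)"
  unfolding cong_def int_wrap by (simp add: mod_add_left_eq)

lemma wrap_cong: "[i = j] (mod int p) \<Longrightarrow> wrap p i = wrap p j"
  unfolding wrap_def cong_def by (metis mod_diff_left_eq)

lemma wrap_eq_iff:
  assumes "1 \<le> p"
  shows "wrap p i = wrap p j \<longleftrightarrow> [i = j] (mod int p)"
  using wrap_cong cong_int_wrap [OF assms] by (metis cong_sym cong_trans)

lemma wrap_eq_p_iff:
  assumes "1 \<le> p"
  shows "wrap p j = p \<longleftrightarrow> int p dvd j"
proof -
  have "wrap p j = p \<longleftrightarrow> [j = int p] (mod int p)"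
    using wrap_eq_iff [OF assms, of j "int p"] wrap_of_nat [of p p] assms by simp
  then show ?thesis by (simp add: cong_def dvd_eq_mod_eq_0)
qed

lemma wrap_diff_eq_p_iff:
  assumes "x \<in> {1..p}" "y \<in> {1..p}"
  shows "wrap p (int x - int y) = p \<longleftrightarrow> x = y"
proof -
  have "1 \<le> p" using assms by auto
  moreover have "int p dvd int x - int y \<longleftrightarrow> x = y"
  proof
    assume "int p dvd int x - int y"
    moreover have "\<bar>int x - int y\<bar> < int p" using assms by auto
    ultimately show "x = y" using zdvd_imp_le [of "int p" "\<bar>int x - int y\<bar>"] by auto
  qed simp
  ultimately show ?thesis by (simp add: wrap_eq_p_iff)
qed

lemma wrap_add_wrap:
  assumes "1 \<le> p"
  shows "wrap p (int (wrap p j) + k) = wrap p (j + k)"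
  by (rule wrap_cong) (intro cong_add cong_int_wrap [OF assms] cong_refl)

lemma wrap_diff_wrap:
  assumes "1 \<le> p"
  shows "wrap p (int (wrap p j) - k) = wrap p (j - k)"
  by (rule wrap_cong) (intro cong_diff cong_int_wrap [OF assms] cong_refl)

text \<open>The explicit form of the powers of \<open>a\<close> (\<open>a_pow\<close>), which shows
  that they depend only on \<open>k\<close> modulo \<open>p\<close>.\<close>

definition rot :: "nat \<Rightarrow> int \<Rightarrow> nat list \<Rightarrow> nat list" where
  "rot p k w = (case w of [] \<Rightarrow> [] | x # v \<Rightarrow>
     if w \<in> vertices (\<lambda>_. p) then wrap p (int x + k) # v else w)"

lemma rot_comp: "1 \<le> p \<Longrightarrow> rot p l \<circ> rot p k = rot p (k + l)"
  by (rule ext) (auto simp: rot_def wrap_add_wrap add.assoc wrap_range [simplified] split: list.split)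

lemma rot_zero: "rot p 0 = id"
  by (rule ext) (auto simp: rot_def wrap_of_nat split: list.split)

lemma rot_cong:
  assumes "[k = l] (mod int p)" shows "rot p k = rot p l"
proof -
  have "wrap p (int x + k) = wrap p (int x + l)" for x
    using assms by (intro wrap_cong cong_add) auto
  then show ?thesis by (simp add: rot_def fun_eq_iff split: list.split)
qed

lemma rot_one: "1 \<le> p \<Longrightarrow> rot p 1 = rooted_a p"
proof (rule ext)
  fix w assume "1 \<le> p"
  have "wrap p (int x + 1) = (if x = p then 1 else x + 1)" if "x \<in> {1..p}" for x
    using that by (auto simp: wrap_def)
  then show "rot p 1 w = rooted_a p w" by (auto simp: rot_def rooted_a_def split: list.split)
qed

section \<open>Powers of \<open>a\<close> and tuples of automorphisms\<close>

locale regular_tree = group A for A :: "(nat list \<Rightarrow> nat list) monoid" (structure) +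
  fixes p :: nat
  assumes A_eq: "A = RegAut p" and p_pos: "1 \<le> p"
begin

abbreviation a where "a \<equiv> rooted_a p"

lemma carrier_A: "carrier A = tree_auts (\<lambda>_. p)"
  by (simp add: A_eq carrier_AutT)

lemma mult_A: "f \<otimes> g = g \<circ> f"
  by (simp add: A_eq AutT_def)

lemma one_A: "\<one> = id"
  by (simp add: A_eq AutT_def)

lemma a_closed [simp, intro]: "a \<in> carrier A"
  using rooted_a_in_AutT A_eq by simp

lemma a_nat_pow: "a [^] (n :: nat) = rot p (int n)"
proof (induction n)
  case 0
  then show ?case by (simp add: one_A rot_zero)
next
  case (Suc n)
  then show ?case
    using rot_comp [OF p_pos, of 1 "int n"] by (simp add: mult_A rot_one [OF p_pos] add.commute)
qed

lemma rot_closed: "rot p k \<in> carrier A"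
proof -
  have "rot p k = rot p (int (nat (k mod int p)))"
    using p_pos by (intro rot_cong) (simp add: cong_def)
  then show ?thesis by (metis a_closed a_nat_pow nat_pow_closed)
qed

lemma a_pow: "a [^] (k :: int) = rot p k"
proof (cases "k < 0")
  case True
  have "a [^] nat (- k) = rot p (- k)" using a_nat_pow [of "nat (- k)"] True by simp
  moreover have "inv (a [^] nat (- k)) = a [^] k"
    using True unfolding int_pow_def2 by simp
  moreover have "inv (rot p (- k)) = rot p k"
  proof (rule inv_equality)
    show "rot p k \<otimes> rot p (- k) = \<one>" by (simp add: mult_A one_A rot_comp [OF p_pos] rot_zero)
    show "rot p (- k) \<in> carrier A" "rot p k \<in> carrier A" using rot_closed by auto
  qed
  ultimately show ?thesis by simp
next
  case False
  then show ?thesis by (simp add: int_pow_def2 a_nat_pow)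
qed

lemma a_pow_cong: "[k = l] (mod int p) \<Longrightarrow> a [^] k = a [^] l"
  by (simp add: a_pow rot_cong)

lemma a_pow_eq_one: "int p dvd k \<Longrightarrow> a [^] k = \<one>"
  using a_pow_cong [of k 0] by (simp add: cong_0_iff)

lemma a_pow_Cons: "x \<in> {1..p} \<Longrightarrow> v \<in> vertices (\<lambda>_. p) \<Longrightarrow>
    (a [^] (k :: int)) (x # v) = wrap p (int x + k) # v"
  by (simp add: a_pow rot_def)

text \<open>The inverse of \<open>\<psi>_1\<close>. Only the values of \<open>f\<close> on
  \<open>{1..p}\<close> matter (\<open>tup_cong\<close>), so families of sections are handled as
  total functions.\<close>

definition tup :: "(nat \<Rightarrow> nat list \<Rightarrow> nat list) \<Rightarrow> nat list \<Rightarrow> nat list" where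
  "tup f w = (case w of [] \<Rightarrow> [] | x # v \<Rightarrow> if x \<in> {1..p} then x # f x v else w)"

lemma tup_Nil [simp]: "tup f [] = []"
  by (simp add: tup_def)

lemma tup_Cons: "x \<in> {1..p} \<Longrightarrow> tup f (x # v) = x # f x v"
  by (simp add: tup_def)

lemma tup_cong: "(\<And>x. x \<in> {1..p} \<Longrightarrow> f x = g x) \<Longrightarrow> tup f = tup g"
  by (auto simp: tup_def fun_eq_iff split: list.split)

lemma tup_closed:
  assumes f: "f \<in> {1..p} \<rightarrow> carrier A"
  shows "tup f \<in> carrier A"
  unfolding carrier_A
proof (rule tree_autsI)
  let ?V = "vertices (\<lambda>_. p)"
  have f: "f x \<in> tree_auts (\<lambda>_. p)" if "x \<in> {1..p}" for x
    using f that by (auto simp: carrier_A)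
  fix w
  show "tup f w \<in> ?V" if "w \<in> ?V"
    using that by (cases w) (auto simp: tup_def tree_auts_in_vertices [OF f])
  show "tup f w = w" if "w \<notin> ?V"
    using that by (cases w) (auto simp: tup_def tree_auts_fix [OF f])
  show "inj_on (tup f) ?V"
  proof (rule inj_onI)
    fix u w assume "u \<in> ?V" "w \<in> ?V" "tup f u = tup f w"
    then show "u = w"
      by (cases u; cases w) (auto simp: tup_def dest: injD [OF tree_auts_inj [OF f], rotated])
  qed
  show "length (tup f w) = length w" if "w \<in> ?V"
    using that by (cases w) (auto simp: tup_def tree_auts_length [OF f])
  fix u x
  show "\<exists>y. tup f (u @ [x]) = tup f u @ [y]" if "u @ [x] \<in> ?V"
  proof (cases u)
    case Nil
    then show ?thesis using that by (simp add: tup_def tree_auts_Nil [OF f])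
  next
    case (Cons z v)
    then have "z \<in> {1..p}" "v @ [x] \<in> ?V" using that by auto
    then show ?thesis using Cons tree_auts_snoc [OF f, of z v x] by (auto simp: tup_def)
  qed
qed

lemma tup_mult: "tup f \<otimes> tup g = tup (\<lambda>x. f x \<otimes> g x)"
proof
  show "(tup f \<otimes> tup g) w = tup (\<lambda>x. f x \<otimes> g x) w" for w
    by (cases w) (simp_all add: mult_A tup_def)
qed

lemma tup_one [simp]: "tup (\<lambda>x. \<one>) = \<one>"
  by (rule ext) (simp add: one_A tup_def split: list.split)

lemma tup_inv:
  assumes f: "f \<in> {1..p} \<rightarrow> carrier A"
  shows "inv (tup f) = tup (\<lambda>x. inv (f x))"
proof (rule inv_equality)
  have "tup (\<lambda>x. inv (f x)) \<otimes> tup f = tup (\<lambda>x. \<one>)"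
    unfolding tup_mult using f by (intro tup_cong) (simp add: Pi_iff)
  then show "tup (\<lambda>x. inv (f x)) \<otimes> tup f = \<one>" by simp
qed (use f in \<open>auto intro!: tup_closed\<close>)

lemma tup_comm:
  assumes "f \<in> {1..p} \<rightarrow> carrier A" "g \<in> {1..p} \<rightarrow> carrier A"
  shows "comm (tup f) (tup g) = tup (\<lambda>x. comm (f x) (g x))"
  using assms by (simp add: comm_def tup_inv tup_mult)

lemma tup_conj:
  assumes "g \<in> {1..p} \<rightarrow> carrier A"
  shows "inv (tup g) \<otimes> tup f \<otimes> tup g = tup (\<lambda>x. inv (g x) \<otimes> f x \<otimes> g x)"
  using assms by (simp add: tup_inv tup_mult)

lemma tup_int_pow:
  assumes f: "f \<in> {1..p} \<rightarrow> carrier A"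
  shows "tup f [^] (k :: int) = tup (\<lambda>x. f x [^] k)"
proof -
  have nat: "tup f [^] (n :: nat) = tup (\<lambda>x. f x [^] n)" for n
    by (induction n) (simp_all add: tup_mult)
  have "inv (tup (\<lambda>x. f x [^] n)) = tup (\<lambda>x. inv (f x [^] n))" for n :: nat
    using f by (intro tup_inv) (simp add: Pi_iff)
  then show ?thesis by (cases "k < 0") (simp_all only: int_pow_def2 nat if_True if_False)
qed

text \<open>The rooted automorphism \<open>a^k\<close> moves the subtree at \<open>x - k\<close> to
  the one at \<open>x\<close> without acting inside it, so conjugation by it shifts the coordinates
  cyclically.\<close>

lemma tup_a_pow:
  assumes f: "f \<in> {1..p} \<rightarrow> carrier A"
  shows "tup f \<otimes> a [^] (k :: int) = a [^] k \<otimes> tup (\<lambda>x. f (wrap p (int x - k)))"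
proof
  fix w
  have "(a [^] k) (tup f w) = tup (\<lambda>x. f (wrap p (int x - k))) ((a [^] k) w)"
  proof (cases "w \<in> vertices (\<lambda>_. p)")
    case True
    then show ?thesis
    proof (cases w)
      case (Cons x v)
      then have x: "x \<in> {1..p}" and v: "v \<in> vertices (\<lambda>_. p)" using True by auto
      then have "f x \<in> tree_auts (\<lambda>_. p)" using f by (auto simp: carrier_A)
      then have "f x v \<in> vertices (\<lambda>_. p)" using v by (simp add: tree_auts_in_vertices)
      moreover have "wrap p (int (wrap p (int x + k)) - k) = x"
        using x by (simp add: wrap_diff_wrap p_pos wrap_of_nat)
      ultimately show ?thesis
        using x v wrap_range [OF p_pos, of "int x + k"] Cons by (simp add: tup_Cons a_pow_Cons)
    qed (simp add: a_pow rot_def)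
  next
    case False
    have ak: "a [^] k \<in> tree_auts (\<lambda>_. p)" using int_pow_closed carrier_A by blast
    have "tup g w = w" if "g \<in> {1..p} \<rightarrow> carrier A" for g
      using tup_closed [OF that] False by (simp add: carrier_A tree_auts_fix)
    then have "tup f w = w" "tup (\<lambda>x. f (wrap p (int x - k))) w = w"
      using f wrap_range [OF p_pos] by (auto simp: Pi_def)
    then show ?thesis using False ak by (simp add: tree_auts_fix)
  qed
  then show "(tup f \<otimes> a [^] k) w = (a [^] k \<otimes> tup (\<lambda>x. f (wrap p (int x - k)))) w"
    by (simp add: mult_A)
qed

lemma tup_shift_closed:
  "f \<in> {1..p} \<rightarrow> X \<Longrightarrow> (\<lambda>x. f (wrap p (g x))) \<in> {1..p} \<rightarrow> X"
  using wrap_range [OF p_pos] by (auto simp: Pi_def)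

lemma tup_conj_a_pow:
  assumes f: "f \<in> {1..p} \<rightarrow> carrier A"
  shows "inv (a [^] (k :: int)) \<otimes> tup f \<otimes> a [^] k = tup (\<lambda>x. f (wrap p (int x - k)))"
  using tup_closed [OF f] tup_closed [OF tup_shift_closed [OF f]] tup_a_pow [OF f, of k]
  by (simp add: m_assoc)

lemma stab_eq_tup:
  assumes g: "g \<in> carrier A" and fix1: "\<And>x. x \<in> {1..p} \<Longrightarrow> g [x] = [x]"
  shows "g = tup (\<lambda>x. sect g [x])" and "x \<in> {1..p} \<Longrightarrow> sect g [x] \<in> carrier A"
proof -
  let ?V = "vertices (\<lambda>_. p)"
  have g': "g \<in> tree_auts (\<lambda>_. p)" using g by (simp add: carrier_A)
  have step: "g (x # v) = x # sect g [x] v" if x: "x \<in> {1..p}" for x v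
  proof (cases "x # v \<in> ?V")
    case True
    then show ?thesis using sect_append [OF g', of "[x]" v] fix1 [OF x] by simp
  next
    case False
    then show ?thesis using tree_auts_fix [OF g' False] by (simp add: sect_def)
  qed
  show "g = tup (\<lambda>x. sect g [x])"
  proof
    fix w show "g w = tup (\<lambda>x. sect g [x]) w"
    proof (cases w)
      case Nil
      then show ?thesis using g' by (simp add: tree_auts_Nil)
    next
      case (Cons x v)
      then show ?thesis
        using step [of x v] tree_auts_fix [OF g', of w] by (auto simp: tup_def)
    qed
  qed
  show "sect g [x] \<in> carrier A" if x: "x \<in> {1..p}"
    unfolding carrier_A
  proof (rule tree_autsI)
    fix w
    show "sect g [x] w \<in> ?V" if "w \<in> ?V"
      using tree_auts_in_vertices [OF g', of "x # w"] step [OF x, of w] that x by simp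
    show "sect g [x] w = w" if "w \<notin> ?V"
      using tree_auts_fix [OF g', of "x # w"] step [OF x, of w] that by simp
    show "inj_on (sect g [x]) ?V"
    proof (rule inj_onI)
      fix u w assume "sect g [x] u = sect g [x] w"
      then have "g (x # u) = g (x # w)" by (simp only: step [OF x])
      then show "u = w" using injD [OF tree_auts_inj [OF g']] by blast
    qed
    show "length (sect g [x] w) = length w"
      using tree_auts_length [OF g', of "x # w"] step [OF x, of w] by simp
    fix u y
    show "\<exists>z. sect g [x] (u @ [y]) = sect g [x] u @ [z]" if "u @ [y] \<in> ?V"
    proof -
      have "(x # u) @ [y] \<in> ?V" using that x by simp
      then obtain z where "g ((x # u) @ [y]) = g (x # u) @ [z]" using tree_auts_snoc [OF g'] by blast
      then show ?thesis using step [OF x] by simp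
    qed
  qed
qed

section \<open>Products over the vertices of a level\<close>

lemma sect_tup: "x \<in> {1..p} \<Longrightarrow> sect (tup f) (x # u) = sect (f x) u"
  by (simp add: sect_def tup_Cons)

lemma sect_Nil [simp]: "sect f [] = f"
  by (simp add: sect_def)

lemma level_const_Suc: "level (\<lambda>_. p) (Suc n) = {x # u | x u. x \<in> {1..p} \<and> u \<in> level (\<lambda>_. p) n}"
  by (auto simp: level_def length_Suc_conv)

lemma replicate_in_level: "replicate n p \<in> level (\<lambda>_. p) n"
  using p_pos by (induction n) (auto simp: level_def)

lemma level_product_0: "K \<subseteq> carrier A \<Longrightarrow> level_product (\<lambda>_. p) 0 K = K"
  by (auto simp: level_product_def level_stab_def level_def A_eq carrier_AutT tree_auts_Nil)

text \<open>Peels off the first level, so that products over any level arise by iterating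
  \<open>tup\<close>.\<close>

lemma level_product_Suc:
  "level_product (\<lambda>_. p) (Suc n) K = tup ` ({1..p} \<rightarrow> level_product (\<lambda>_. p) n K)"
proof (intro equalityI subsetI)
  fix g assume g: "g \<in> level_product (\<lambda>_. p) (Suc n) K"
  then have gA: "g \<in> carrier A" and fx: "\<And>u. u \<in> level (\<lambda>_. p) (Suc n) \<Longrightarrow> g u = u \<and> sect g u \<in> K"
    by (auto simp: level_product_def level_stab_def A_eq)
  \<comment> \<open>A vertex of level one is fixed because a vertex of level \<open>Suc n\<close>
    below it is; the word \<open>p ... p\<close> serves as the extension.\<close>
  have g1: "g [x] = [x]" if x: "x \<in> {1..p}" for x
  proof -
    have lev: "x # replicate n p \<in> level (\<lambda>_. p) (Suc n)"
      using replicate_in_level x by (auto simp: level_const_Suc)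
    then have "[x] @ replicate n p \<in> vertices (\<lambda>_. p)" by (simp add: level_def)
    then have "g [x] @ sect g [x] (replicate n p) = x # replicate n p"
      using sect_append [of g "\<lambda>_. p" "[x]" "replicate n p"] gA fx [OF lev] by (simp add: carrier_A)
    moreover have "length (g [x]) = 1" using tree_auts_length [of g] gA by (simp add: carrier_A)
    ultimately show ?thesis by (cases "g [x]") auto
  qed
  note st = stab_eq_tup [OF gA g1]
  have "sect g [x] \<in> level_product (\<lambda>_. p) n K" if x: "x \<in> {1..p}" for x
  proof -
    have "sect g [x] u = u \<and> sect (sect g [x]) u \<in> K" if u: "u \<in> level (\<lambda>_. p) n" for u
    proof -
      have "x # u \<in> level (\<lambda>_. p) (Suc n)" using x u by (auto simp: level_const_Suc)
      note fx [OF this]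
      moreover have "g (x # u) = x # sect g [x] u" using fun_cong [OF st(1), of "x # u"] tup_Cons [OF x, of "\<lambda>x. sect g [x]" u] by simp
      moreover have "sect g (x # u) = sect (sect g [x]) u" using arg_cong [OF st(1), of "\<lambda>f. sect f (x # u)"] sect_tup [OF x, of "\<lambda>x. sect g [x]" u] by simp
      ultimately show ?thesis by simp
    qed
    then show ?thesis using st(2) [OF _ x] g1 by (simp add: level_product_def level_stab_def A_eq)
  qed
  then show "g \<in> tup ` ({1..p} \<rightarrow> level_product (\<lambda>_. p) n K)"
    using st(1) g1 by (intro image_eqI [of _ _ "\<lambda>x. sect g [x]"]) auto
next
  fix g assume "g \<in> tup ` ({1..p} \<rightarrow> level_product (\<lambda>_. p) n K)"
  then obtain f where f: "f \<in> {1..p} \<rightarrow> level_product (\<lambda>_. p) n K" and gf: "g = tup f" by auto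
  have "f \<in> {1..p} \<rightarrow> carrier A" using f by (auto simp: level_product_def level_stab_def A_eq)
  then have "g \<in> carrier A" using gf tup_closed by simp
  moreover have "g u = u \<and> sect g u \<in> K" if "u \<in> level (\<lambda>_. p) (Suc n)" for u
  proof -
    obtain x v where u: "u = x # v" "x \<in> {1..p}" "v \<in> level (\<lambda>_. p) n"
      using \<open>u \<in> level (\<lambda>_. p) (Suc n)\<close> by (auto simp: level_const_Suc)
    then have "f x \<in> level_product (\<lambda>_. p) n K" using f by auto
    then have "f x v = v" "sect (f x) v \<in> K" using u(3) by (auto simp: level_product_def level_stab_def)
    then show ?thesis using u(1,2) gf by (simp add: tup_Cons sect_tup)
  qed
  ultimately show "g \<in> level_product (\<lambda>_. p) (Suc n) K"
    by (simp add: level_product_def level_stab_def A_eq)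
qed

end

section \<open>A branching criterion\<close>

text \<open>The last two assumptions express that \<open>G\<close> lies in the wreath product of
  \<open>G\<close> with the powers of \<open>a\<close>, and that its level-one stabilizer projects
  onto \<open>G\<close> at the vertex \<open>p\<close>.\<close>

locale self_similar = regular_tree +
  fixes G :: "(nat list \<Rightarrow> nat list) set"
  assumes sub_G: "subgroup G A"
    and a_in_G: "a \<in> G"
    and decomp: "g \<in> G \<Longrightarrow> \<exists>f\<in>{1..p} \<rightarrow> G. \<exists>k :: int. g = tup f \<otimes> a [^] k"
    and stab_onto: "u \<in> G \<Longrightarrow> \<exists>f\<in>{1..p} \<rightarrow> G. tup f \<in> G \<and> f p = u"
begin

definition delta :: "nat \<Rightarrow> (nat list \<Rightarrow> nat list) \<Rightarrow> nat list \<Rightarrow> nat list" where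
  "delta k g = tup (\<lambda>x. if x = k then g else \<one>)"

lemma G_carrier: "g \<in> G \<Longrightarrow> g \<in> carrier A"
  by (rule subgroup.mem_carrier [OF sub_G])

lemma Pi_G_carrier: "f \<in> {1..p} \<rightarrow> G \<Longrightarrow> f \<in> {1..p} \<rightarrow> carrier A"
  using G_carrier by auto

lemma a_pow_in_G: "a [^] (k :: int) \<in> G"
  by (rule subgroup_int_pow_closed [OF sub_G a_in_G])

lemma delta_mult: "g \<in> carrier A \<Longrightarrow> h \<in> carrier A \<Longrightarrow> delta k (g \<otimes> h) = delta k g \<otimes> delta k h"
  unfolding delta_def tup_mult by (intro tup_cong) auto

lemma delta_inv: "g \<in> carrier A \<Longrightarrow> delta k (inv g) = inv (delta k g)"
  unfolding delta_def by (subst tup_inv) (auto intro: tup_cong)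

lemma delta_one [simp]: "delta k \<one> = \<one>"
  unfolding delta_def by simp

lemma delta_conj:
  assumes f: "f \<in> {1..p} \<rightarrow> carrier A" and k: "k \<in> {1..p}" and g: "g \<in> carrier A"
  shows "inv (tup f) \<otimes> delta k g \<otimes> tup f = delta k (inv (f k) \<otimes> g \<otimes> f k)"
  unfolding delta_def tup_conj [OF f] using f k g by (intro tup_cong) (auto simp: Pi_iff)

text \<open>\<open>a^k\<close> carries the vertex \<open>p\<close> to \<open>k\<close>, so normality
  under \<open>a\<close> reduces all vertices to \<open>p\<close>.\<close>

lemma delta_shift:
  assumes k: "k \<in> {1..p}" and g: "g \<in> carrier A"
  shows "delta k g = inv (a [^] int k) \<otimes> delta p g \<otimes> a [^] int k"
proof -
  show ?thesis
    unfolding delta_def using g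
    by (subst tup_conj_a_pow) (auto intro!: tup_cong simp: wrap_diff_eq_p_iff [OF _ k])
qed

text \<open>A tuple is the product of its one-coordinate parts; the induction truncates the tuple
  after coordinate \<open>m\<close>.\<close>

lemma tup_mem_of_delta:
  assumes K: "subgroup K A" and f: "f \<in> {1..p} \<rightarrow> carrier A"
    and d: "\<And>k. k \<in> {1..p} \<Longrightarrow> delta k (f k) \<in> K"
  shows "tup f \<in> K"
proof -
  have "tup (\<lambda>x. if x \<le> m then f x else \<one>) \<in> K" if "m \<le> p" for m
    using that
  proof (induction m)
    case 0
    have "tup (\<lambda>x. if x \<le> 0 then f x else \<one>) = tup (\<lambda>x. \<one>)" by (intro tup_cong) auto
    then show ?case using subgroup.one_closed [OF K] by simp
  next
    case (Suc m)
    have fm: "f (Suc m) \<in> carrier A" using f Suc.prems by (simp add: Pi_iff)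
    have "tup (\<lambda>x. if x \<le> Suc m then f x else \<one>)
        = tup (\<lambda>x. if x \<le> m then f x else \<one>) \<otimes> delta (Suc m) (f (Suc m))"
      unfolding delta_def tup_mult using f fm by (intro tup_cong) (auto simp: Pi_iff le_Suc_eq)
    then show ?case using Suc d [of "Suc m"] by (auto intro!: subgroup.m_closed [OF K])
  qed
  from this [of p] have "tup (\<lambda>x. if x \<le> p then f x else \<one>) \<in> K" by simp
  moreover have "tup (\<lambda>x. if x \<le> p then f x else \<one>) = tup f" by (intro tup_cong) auto
  ultimately show ?thesis by simp
qed

text \<open>Given \<open>u\<close>, choose \<open>tup f\<close> in \<open>G\<close> with
  \<open>f p = u\<close>: conjugating \<open>delta p g\<close> by it conjugates the coordinate at
  \<open>p\<close> by \<open>u\<close> and leaves the others trivial.\<close>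

lemma normal_in_delta:
  assumes K: "normal_in K G"
  shows "normal_in {g \<in> G. delta p g \<in> K} G" (is "normal_in ?M G")
proof -
  note K1 = normal_inD(1) [OF K]
  have pp: "p \<in> {1..p}" using p_pos by simp
  have "subgroup ?M A"
  proof (rule subgroupI)
    show "?M \<subseteq> carrier A" using G_carrier by auto
    show "?M \<noteq> {}" using subgroup.one_closed [OF sub_G] subgroup.one_closed [OF K1] by auto
    show "inv g \<in> ?M" if "g \<in> ?M" for g
      using that G_carrier by (auto simp: delta_inv subgroup.m_inv_closed [OF sub_G] subgroup.m_inv_closed [OF K1])
    show "g \<otimes> h \<in> ?M" if "g \<in> ?M" "h \<in> ?M" for g h
      using that G_carrier by (auto simp: delta_mult subgroup.m_closed [OF sub_G] subgroup.m_closed [OF K1])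
  qed
  moreover have "inv u \<otimes> g \<otimes> u \<in> ?M" if u: "u \<in> G" and g: "g \<in> ?M" for u g
  proof -
    obtain f where f: "f \<in> {1..p} \<rightarrow> G" "tup f \<in> G" "f p = u" using stab_onto [OF u] by auto
    have "delta p (inv u \<otimes> g \<otimes> u) = inv (tup f) \<otimes> delta p g \<otimes> tup f"
      using delta_conj [OF Pi_G_carrier [OF f(1)] pp, of g] g G_carrier f(3) by simp
    also have "\<dots> \<in> K" using normal_inD(3) [OF K f(2)] g by simp
    finally show ?thesis
      using u g by (auto intro!: subgroup.m_closed [OF sub_G] subgroup.m_inv_closed [OF sub_G])
  qed
  ultimately show ?thesis by (auto simp: normal_in_def)
qed

lemma tup_image_subset:
  assumes K: "normal_in K G" and d: "\<And>g. g \<in> K \<Longrightarrow> delta p g \<in> K" and P: "P \<subseteq> K"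
  shows "tup ` ({1..p} \<rightarrow> P) \<subseteq> K"
proof
  fix g assume "g \<in> tup ` ({1..p} \<rightarrow> P)"
  then obtain f where f: "f \<in> {1..p} \<rightarrow> P" "g = tup f" by auto
  have fK: "f k \<in> K" if "k \<in> {1..p}" for k using f(1) P that by auto
  then have fA: "f k \<in> carrier A" if "k \<in> {1..p}" for k
    using that subgroup.mem_carrier [OF normal_inD(1) [OF K]] by blast
  show "g \<in> K"
    unfolding f(2)
  proof (rule tup_mem_of_delta [OF normal_inD(1) [OF K]])
    show "delta k (f k) \<in> K" if "k \<in> {1..p}" for k
      unfolding delta_shift [OF that fA [OF that]]
      by (rule normal_inD(3) [OF K a_pow_in_G d [OF fK [OF that]]])
  qed (use fA in auto)
qed

text \<open>An element of \<open>G\<close> is \<open>tup u\<close> followed by \<open>a^k\<close>: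
  the first conjugates each coordinate inside \<open>P\<close>, the second permutes the
  coordinates.\<close>

lemma normal_in_tup_image:
  assumes P: "normal_in P G" and sub: "tup ` ({1..p} \<rightarrow> P) \<subseteq> G"
  shows "normal_in (tup ` ({1..p} \<rightarrow> P)) G" (is "normal_in ?T G")
proof -
  note P1 = normal_inD(1) [OF P]
  have PA: "f \<in> {1..p} \<rightarrow> carrier A" if "f \<in> {1..p} \<rightarrow> P" for f
    using that subgroup.mem_carrier [OF P1] by auto
  have "subgroup ?T A"
  proof (rule subgroupI)
    show "?T \<subseteq> carrier A" using sub G_carrier by auto
    show "?T \<noteq> {}" using subgroup.one_closed [OF P1] by auto
    show "inv g \<in> ?T" if g: "g \<in> ?T" for g
    proof -
      obtain f where f: "f \<in> {1..p} \<rightarrow> P" "g = tup f" using g by auto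
      then have "inv g = tup (\<lambda>x. inv (f x))" using tup_inv PA by simp
      then show ?thesis using f subgroup.m_inv_closed [OF P1] by auto
    qed
    show "g \<otimes> h \<in> ?T" if g: "g \<in> ?T" and h: "h \<in> ?T" for g h
    proof -
      obtain f where f: "f \<in> {1..p} \<rightarrow> P" "g = tup f" using g by auto
      obtain f' where f': "f' \<in> {1..p} \<rightarrow> P" "h = tup f'" using h by auto
      have "g \<otimes> h = tup (\<lambda>x. f x \<otimes> f' x)" using f f' tup_mult by simp
      moreover have "(\<lambda>x. f x \<otimes> f' x) \<in> {1..p} \<rightarrow> P"
        using f(1) f'(1) subgroup.m_closed [OF P1] by (simp add: Pi_iff)
      ultimately show ?thesis by blast
    qed
  qed
  moreover have "inv h \<otimes> g \<otimes> h \<in> ?T" if h: "h \<in> G" and g: "g \<in> ?T" for g h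
  proof -
    obtain f where f: "f \<in> {1..p} \<rightarrow> P" "g = tup f" using g by auto
    obtain u and k :: int where u: "u \<in> {1..p} \<rightarrow> G" "h = tup u \<otimes> a [^] k" using decomp [OF h] by auto
    let ?f = "\<lambda>x. inv (u x) \<otimes> f x \<otimes> u x"
    have fP: "?f \<in> {1..p} \<rightarrow> P" using f(1) u(1) normal_inD(3) [OF P] by auto
    have "inv h \<otimes> g \<otimes> h = inv (a [^] k) \<otimes> (inv (tup u) \<otimes> tup f \<otimes> tup u) \<otimes> a [^] k"
      using tup_closed [OF PA [OF f(1)]] tup_closed [OF Pi_G_carrier [OF u(1)]]
      by (simp add: f(2) u(2) m_assoc inv_mult_group)
    also have "\<dots> = tup (\<lambda>x. ?f (wrap p (int x - k)))"
      using tup_conj_a_pow [OF PA [OF fP], of k] tup_conj [OF Pi_G_carrier [OF u(1)], of f] by simp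
    also have "\<dots> \<in> ?T" using tup_shift_closed [OF fP] by (intro imageI)
    finally show ?thesis .
  qed
  ultimately show ?thesis using sub by (simp add: normal_in_def)
qed

text \<open>With representatives chosen coordinatewise and \<open>k\<close> reduced modulo
  \<open>p\<close>, finitely many products \<open>tup t a^k\<close> remain.\<close>

lemma finite_cover_tup_image:
  assumes P: "normal_in P G" and cov: "finite_cover P G"
  shows "finite_cover (tup ` ({1..p} \<rightarrow> P)) G"
proof -
  have PA: "n \<in> carrier A" if "n \<in> P" for n
    using that subgroup.mem_carrier [OF normal_inD(1) [OF P]] by auto
  obtain F where F: "finite F" "F \<subseteq> carrier A" "\<forall>g\<in>G. \<exists>n\<in>P. \<exists>t\<in>F. g = n \<otimes> t"
    using cov unfolding finite_cover_def by blast
  define F' where "F' = (\<lambda>(t, k). tup t \<otimes> a [^] k) ` ((PiE {1..p} (\<lambda>_. F)) \<times> {0..<int p})"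
  have "finite F'" unfolding F'_def using F(1) by (intro finite_imageI finite_cartesian_product finite_PiE) auto
  moreover have "F' \<subseteq> carrier A"
  proof -
    have "tup t \<in> carrier A" if "t \<in> PiE {1..p} (\<lambda>_. F)" for t
      using that F(2) by (intro tup_closed) (auto simp: PiE_def)
    then show ?thesis unfolding F'_def by auto
  qed
  moreover have "\<exists>n\<in>tup ` ({1..p} \<rightarrow> P). \<exists>t\<in>F'. g = n \<otimes> t" if g: "g \<in> G" for g
  proof -
    obtain f and k :: int where f: "f \<in> {1..p} \<rightarrow> G" "g = tup f \<otimes> a [^] k" using decomp [OF g] by auto
    have "\<forall>x\<in>{1..p}. \<exists>n t. n \<in> P \<and> t \<in> F \<and> f x = n \<otimes> t" using f(1) F(3) by blast
    then obtain n t where nt: "\<And>x. x \<in> {1..p} \<Longrightarrow> n x \<in> P \<and> t x \<in> F \<and> f x = n x \<otimes> t x" by metis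
    define t' where "t' = restrict t {1..p}"
    have t': "t' \<in> PiE {1..p} (\<lambda>_. F)" using nt by (simp add: t'_def)
    have nP: "n \<in> {1..p} \<rightarrow> P" using nt by blast
    have "tup f = tup n \<otimes> tup t'"
      unfolding tup_mult using nt by (intro tup_cong) (simp add: t'_def)
    moreover have "a [^] k = a [^] (k mod int p)" by (rule a_pow_cong) (simp add: cong_def)
    moreover have "tup n \<in> carrier A" using nP PA by (intro tup_closed) blast
    moreover have "tup t' \<in> carrier A" using t' F(2) by (intro tup_closed) (auto simp: PiE_def)
    ultimately have "g = tup n \<otimes> (tup t' \<otimes> a [^] (k mod int p))"
      using f(2) by (simp add: m_assoc)
    moreover have "tup t' \<otimes> a [^] (k mod int p) \<in> F'"
      unfolding F'_def using t' p_pos by (intro image_eqI [of _ _ "(t', k mod int p)"]) auto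
    ultimately show ?thesis using nP by blast
  qed
  ultimately show ?thesis unfolding finite_cover_def by (intro exI [of _ F']) simp
qed

text \<open>Containment in \<open>K\<close> is carried through the induction because it keeps the
  next \<open>tup\<close> image inside \<open>K\<close>, hence inside \<open>G\<close>.\<close>

lemma level_product_properties:
  assumes K: "normal_in K G" and cov: "finite_cover K G"
    and d: "\<And>g. g \<in> K \<Longrightarrow> delta p g \<in> K"
  shows "normal_in (level_product (\<lambda>_. p) n K) G \<and> level_product (\<lambda>_. p) n K \<subseteq> K \<and>
    finite_cover (level_product (\<lambda>_. p) n K) G"
proof (induction n)
  case 0
  have "K \<subseteq> carrier A" using normal_inD(2) [OF K] G_carrier by auto
  then show ?case using level_product_0 K cov by simp
next
  case (Suc n)
  let ?P = "level_product (\<lambda>_. p) n K"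
  have sub: "tup ` ({1..p} \<rightarrow> ?P) \<subseteq> K" using tup_image_subset [OF K d] Suc by blast
  then have "tup ` ({1..p} \<rightarrow> ?P) \<subseteq> G" using normal_inD(2) [OF K] by auto
  then show ?case
    unfolding level_product_Suc using sub Suc normal_in_tup_image [of ?P] finite_cover_tup_image [of ?P]
    by blast
qed

text \<open>Move the first letter to \<open>p\<close> by a power of \<open>a\<close>, then act below
  \<open>p\<close> by a tuple in \<open>G\<close> whose section there comes from the
  induction.\<close>

lemma level_transitive_to_last:
  "u \<in> level (\<lambda>_. p) n \<Longrightarrow> \<exists>g\<in>G. g u = replicate n p"
proof (induction n arbitrary: u)
  case 0
  then show ?case using subgroup.one_closed [OF sub_G] by (intro bexI [of _ \<one>]) (auto simp: level_def one_A)
next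
  case (Suc n)
  then obtain x v where u: "u = x # v" "x \<in> {1..p}" "v \<in> level (\<lambda>_. p) n"
    by (auto simp: level_const_Suc)
  obtain g where g: "g \<in> G" "g v = replicate n p" using Suc.IH [OF u(3)] by auto
  obtain f where f: "tup f \<in> G" "f p = g" using stab_onto [OF g(1)] by auto
  have "wrap p (int x + - int x) = p" using wrap_eq_p_iff [OF p_pos] by simp
  then have "(a [^] (- int x)) u = p # v" using u a_pow_Cons [OF u(2), of v "- int x"] by (simp add: level_def)
  then have "(a [^] (- int x) \<otimes> tup f) u = replicate (Suc n) p"
    using f(2) g(2) p_pos by (simp add: mult_A tup_Cons)
  moreover have "a [^] (- int x) \<otimes> tup f \<in> G" using f(1) a_pow_in_G subgroup.m_closed [OF sub_G] by blast
  ultimately show ?case by blast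
qed

lemma level_transitive:
  assumes "u \<in> level (\<lambda>_. p) n" "v \<in> level (\<lambda>_. p) n"
  shows "\<exists>g\<in>G. g u = v"
proof -
  obtain g where g: "g \<in> G" "g u = replicate n p" using level_transitive_to_last assms(1) by blast
  obtain h where h: "h \<in> G" "h v = replicate n p" using level_transitive_to_last assms(2) by blast
  have "h \<otimes> inv h = \<one>" using G_carrier [OF h(1)] by simp
  then have "(inv h) (h v) = v" by (metis mult_A one_A comp_apply id_apply)
  then have "(g \<otimes> inv h) u = v" using g h by (simp add: mult_A)
  moreover have "g \<otimes> inv h \<in> G"
    using g h by (intro subgroup.m_closed [OF sub_G] subgroup.m_inv_closed [OF sub_G])
  ultimately show ?thesis by blast
qed

text \<open>The embedding is the inclusion, and \<open>K\<close> serves as \<open>L_n\<close> on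
  every level.\<close>

theorem branch_group_if_delta_closed:
  assumes p2: "2 \<le> p" and K: "normal_in K G" and cov: "finite_cover K G"
    and d: "\<And>g. g \<in> K \<Longrightarrow> delta p g \<in> K"
  shows "branch_group (A\<lparr>carrier := G\<rparr>)"
proof -
  let ?m = "\<lambda>_ :: nat. p"
  have "group (A\<lparr>carrier := G\<rparr>)" by (rule subgroup_imp_group [OF sub_G])
  moreover have "id \<in> hom (A\<lparr>carrier := G\<rparr>) (AutT ?m)"
    using G_carrier by (auto simp: hom_def A_eq)
  moreover have "\<exists>L. subgroup L (AutT (subtree n ?m)) \<and>
      level_product ?m n L \<lhd> (AutT ?m)\<lparr>carrier := id ` carrier (A\<lparr>carrier := G\<rparr>)\<rparr> \<and>
      finite (rcosets\<^bsub>(AutT ?m)\<lparr>carrier := id ` carrier (A\<lparr>carrier := G\<rparr>)\<rparr>\<^esub> level_product ?m n L)" for n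
  proof (intro exI conjI)
    note lp = level_product_properties [OF K cov d, of n]
    show "subgroup K (AutT (subtree n ?m))" using normal_inD(1) [OF K] by (simp add: A_eq)
    show "level_product ?m n K \<lhd> (AutT ?m)\<lparr>carrier := id ` carrier (A\<lparr>carrier := G\<rparr>)\<rparr>"
      using normal_of_normal_in [OF _ sub_G] lp by (simp add: A_eq)
    show "finite (rcosets\<^bsub>(AutT ?m)\<lparr>carrier := id ` carrier (A\<lparr>carrier := G\<rparr>)\<rparr>\<^esub> level_product ?m n K)"
      using finite_rcosets_of_cover [OF _ sub_G] lp by (simp add: A_eq)
  qed
  moreover have "\<forall>n. \<forall>u\<in>level ?m n. \<forall>v\<in>level ?m n. \<exists>g\<in>carrier (A\<lparr>carrier := G\<rparr>). id g u = v"
    using level_transitive by simp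
  ultimately show ?thesis
    unfolding branch_group_def using p2
    by (intro conjI exI [of _ ?m] exI [of _ id]) simp_all
qed

end

section \<open>Multi-edge spinal groups\<close>

lemma prime_mult_inverse_int:
  assumes "Factorial_Ring.prime (p :: nat)" "\<not> int p dvd x"
  obtains y :: int where "[x * y = 1] (mod int p)"
proof -
  have "coprime (int p) x" using assms by (intro prime_imp_coprime) auto
  then show thesis using cong_solve_coprime_int [of x "int p"] that by (auto simp: coprime_commute)
qed

lemma fermat_theorem_int:
  assumes p: "Factorial_Ring.prime (p :: nat)" and x: "\<not> int p dvd x"
  shows "[x ^ (p - 1) = 1] (mod int p)"
proof -
  have p0: "int p > 0" using prime_gt_0_nat [OF p] by simp
  define n where "n = nat (x mod int p)"
  have n: "int n = x mod int p" using p0 by (simp add: n_def)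
  have cong: "[int n = x] (mod int p)" by (simp add: n cong_def)
  then have "\<not> p dvd n" using x by (metis cong_dvd_iff cong_sym int_dvd_int_iff)
  then have "[n ^ (p - 1) = 1] (mod p)" using p by (intro fermat_theorem)
  then have "[int n ^ (p - 1) = 1] (mod int p)" by (metis cong_int_iff of_nat_1 of_nat_power)
  then show ?thesis using cong_pow [OF cong, of "p - 1"] by (metis cong_sym cong_trans)
qed

text \<open>Iterating the functional equation gives \<open>s ^ (n - 1) * e (n * l) \<equiv> e l ^ n\<close>; for
  \<open>n = p - 1\<close> Fermat's theorem turns this into \<open>e (- l) \<equiv> s\<close>.\<close>

lemma constant_of_multiplicative:
  fixes e :: "int \<Rightarrow> int"
  assumes p: "Factorial_Ring.prime (p :: nat)" and "odd p"
    and per: "\<And>i j. [i = j] (mod int p) \<Longrightarrow> e i = e j"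
    and nz: "\<And>j. \<not> int p dvd j \<Longrightarrow> \<not> int p dvd e j"
    and mult: "\<And>l j. \<not> int p dvd l \<Longrightarrow> \<not> int p dvd j \<Longrightarrow> \<not> int p dvd l + j \<Longrightarrow>
      [e l * e j = s * e (l + j)] (mod int p)"
    and j: "\<not> int p dvd j"
  shows "[e j = s] (mod int p)"
proof -
  have p3: "p \<ge> 3" using prime_ge_2_nat [OF p] \<open>odd p\<close> by (cases "p = 2") auto
  have pp: "Factorial_Ring.prime (int p)" using p by simp
  define l where "l = - j"
  have l: "\<not> int p dvd l" using j by (simp add: l_def)
  \<comment> \<open>\<open>s\<close> is nonzero because \<open>e 1 * e 1 = s * e 2\<close> modulo
    \<open>p\<close>; the index \<open>1 + 1\<close> is nonzero as \<open>p\<close> is odd.\<close>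
  have s: "\<not> int p dvd s"
  proof
    assume "int p dvd s"
    have "\<not> int p dvd 2" "\<not> int p dvd 1" using p3 zdvd_imp_le [of "int p" 2] zdvd_imp_le [of "int p" 1] by auto
    then have "[e 1 * e 1 = s * e 2] (mod int p)" using mult [of 1 1] by simp
    then have "int p dvd e 1 * e 1" using \<open>int p dvd s\<close> by (simp add: cong_dvd_iff)
    then show False using nz [of 1] \<open>\<not> int p dvd 1\<close> prime_dvd_multD [OF pp] by blast
  qed
  have iter: "[s ^ n * e (int (Suc n) * l) = e l ^ Suc n] (mod int p)" if "Suc n < p" for n
    using that
  proof (induction n)
    case (Suc n)
    have nd: "\<not> int p dvd int m * l" if "0 < m" "m < p" for m
      using that l prime_dvd_multD [OF pp, of "int m" l] nat_dvd_not_less [of m p] by auto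
    have "l + int (Suc n) * l = int (Suc (Suc n)) * l" by (simp add: algebra_simps)
    then have "[e l * e (int (Suc n) * l) = s * e (int (Suc (Suc n)) * l)] (mod int p)"
      using mult [OF l nd [of "Suc n"]] nd [of "Suc (Suc n)"] Suc.prems by simp
    then have "[s ^ n * (e l * e (int (Suc n) * l)) = s ^ n * (s * e (int (Suc (Suc n)) * l))] (mod int p)"
      by (rule cong_scalar_left)
    moreover have "[e l * (s ^ n * e (int (Suc n) * l)) = e l * e l ^ Suc n] (mod int p)"
      using Suc by (intro cong_scalar_left) simp
    ultimately show ?case by (simp add: mult_ac cong_def)
  qed simp
  have "[s ^ (p - 2) * e (int (p - 1) * l) = e l ^ (p - 1)] (mod int p)"
    using iter [of "p - 2"] p3 by (simp add: Suc_diff_Suc numeral_2_eq_2)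
  moreover have "e (int (p - 1) * l) = e j"
    using p3 by (intro per) (simp add: l_def cong_iff_dvd_diff of_nat_diff algebra_simps)
  moreover have "[e l ^ (p - 1) = 1] (mod int p)" by (rule fermat_theorem_int [OF p nz [OF l]])
  ultimately have "[s ^ (p - 2) * e j = 1] (mod int p)" by (metis cong_trans)
  then have "[s * (s ^ (p - 2) * e j) = s * 1] (mod int p)" by (rule cong_scalar_left)
  moreover have "s * (s ^ (p - 2) * e j) = s ^ (p - 1) * e j"
    using p3 power_Suc [of s "p - 2"] by (simp add: Suc_diff_Suc numeral_2_eq_2 mult_ac)
  moreover have "[s ^ (p - 1) * e j = 1 * e j] (mod int p)"
    by (intro cong_scalar_right fermat_theorem_int [OF p s])
  ultimately show ?thesis by (simp add: cong_def)
qed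

section \<open>Spinal automorphisms with arbitrary exponent vectors\<close>

context regular_tree
begin

lemma a_pow_mult: "a [^] (k :: int) \<otimes> a [^] (l :: int) = a [^] (k + l)"
  by (simp add: int_pow_mult)

lemma comm_a_pow [simp]: "comm (a [^] (k :: int)) (a [^] (l :: int)) = \<one>"
  by (rule comm_eq_one) (simp_all add: a_pow_mult add.commute)

lemma a_mem_of_pow:
  assumes X: "subgroup X A" and "Factorial_Ring.prime p" "a [^] (k :: int) \<in> X" "\<not> int p dvd k"
  shows "a \<in> X"
proof -
  obtain y where y: "[k * y = 1] (mod int p)" using prime_mult_inverse_int assms(2,4) by blast
  have "(a [^] k) [^] y \<in> X" by (rule subgroup_int_pow_closed [OF X assms(3)])
  moreover have "(a [^] k) [^] y = a [^] (1 :: int)" using a_pow_cong [OF y] by (simp add: int_pow_pow)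
  ultimately show ?thesis by (simp add: int_pow_1)
qed

definition spinal :: "(nat \<Rightarrow> int) \<Rightarrow> nat \<Rightarrow> nat list \<Rightarrow> nat list" where
  "spinal e x = (if x = p then spinal_b p e else a [^] e x)"

lemma spinal_b_closed [simp, intro]: "spinal_b p e \<in> carrier A"
  using spinal_b_in_stab [OF p_pos, of e] by (simp add: level_stab_def A_eq)

lemma spinal_closed: "spinal e \<in> {1..p} \<rightarrow> carrier A"
  by (auto simp: spinal_def)

lemma spinal_b_step: "spinal_b p e (x # v) =
    x # (if x = p then spinal_b p e v else if x \<in> {1..p - 1} then (a [^] e x) v else v)"
  by (simp add: A_eq)

lemma spinal_b_eq_tup: "spinal_b p e = tup (spinal e)"
proof
  show "spinal_b p e w = tup (spinal e) w" for w
    by (cases w) (use p_pos in \<open>auto simp: spinal_b_step tup_def spinal_def simp del: spinal_b.simps(2)\<close>)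
qed

lemma spinal_b_cong:
  assumes "\<And>j. j \<in> {1..p - 1} \<Longrightarrow> [e j = e' j] (mod int p)"
  shows "spinal_b p e = spinal_b p e'"
proof
  show "spinal_b p e w = spinal_b p e' w" for w
    by (induction w) (use a_pow_cong [OF assms] in \<open>auto simp: spinal_b_step simp del: spinal_b.simps(2)\<close>)
qed

text \<open>Along the ray \<open>p p p ...\<close> both sides recur, and off it the sections are
  powers of \<open>a\<close>, whose exponents add. So vectors map homomorphically to automorphisms,
  and the \<open>b_i\<close> commute.\<close>

lemma spinal_b_add: "spinal_b p e \<otimes> spinal_b p e' = spinal_b p (\<lambda>j. e j + e' j)"
proof
  have "(a [^] (k + l)) v = (a [^] l) ((a [^] k) v)" for k l :: int and v
    by (simp add: a_pow_mult [symmetric] mult_A)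
  then show "(spinal_b p e \<otimes> spinal_b p e') w = spinal_b p (\<lambda>j. e j + e' j) w" for w
    by (induction w) (auto simp: mult_A spinal_b_step simp del: spinal_b.simps(2))
qed

lemma spinal_b_zero: "spinal_b p (\<lambda>_. 0) = \<one>"
proof
  show "spinal_b p (\<lambda>_. 0) w = \<one> w" for w
    by (induction w) (auto simp: one_A spinal_b_step simp del: spinal_b.simps(2))
qed

lemma spinal_b_commute: "spinal_b p e \<otimes> spinal_b p e' = spinal_b p e' \<otimes> spinal_b p e"
  by (simp add: spinal_b_add add.commute)

lemma spinal_b_inv: "inv (spinal_b p e) = spinal_b p (\<lambda>j. - e j)"
  by (rule inv_equality) (simp_all add: spinal_b_add spinal_b_zero)

lemma spinal_b_pow: "spinal_b p e [^] (k :: int) = spinal_b p (\<lambda>j. k * e j)"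
proof -
  have nat: "spinal_b p e [^] (n :: nat) = spinal_b p (\<lambda>j. int n * e j)" for n
    by (induction n) (simp_all add: spinal_b_zero spinal_b_add algebra_simps)
  show ?thesis by (simp add: int_pow_def2 nat spinal_b_inv)
qed

lemma spinal_b_pow_cong:
  assumes "[k = l] (mod int p)"
  shows "spinal_b p e [^] (k :: int) = spinal_b p e [^] (l :: int)"
  unfolding spinal_b_pow by (intro spinal_b_cong cong_scalar_right assms)

definition spinal_conj :: "(nat \<Rightarrow> int) \<Rightarrow> int \<Rightarrow> nat list \<Rightarrow> nat list" where
  "spinal_conj e k = tup (\<lambda>x. spinal e (wrap p (int x - k)))"

lemma spinal_conj_eq: "spinal_conj e k = inv (a [^] k) \<otimes> spinal_b p e \<otimes> a [^] k"
  unfolding spinal_conj_def spinal_b_eq_tup by (rule tup_conj_a_pow [OF spinal_closed, symmetric])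

lemma spinal_p [simp]: "spinal e p = spinal_b p e"
  by (simp add: spinal_def)

lemma spinal_neq_p: "x \<noteq> p \<Longrightarrow> spinal e x = a [^] e x"
  by (simp add: spinal_def)

text \<open>The sections of \<open>spinal_b\<close> are powers of \<open>a\<close> except at
  \<open>p\<close>, those of the conjugate except at \<open>l\<close>. Powers of \<open>a\<close>
  commute, so only these two vertices contribute.\<close>

lemma comm_spinal_b_spinal_conj:
  assumes l: "l \<in> {1..p - 1}"
  shows "comm (spinal_b p v) (spinal_conj w (int l)) =
    tup (\<lambda>x. if x = p then comm (spinal_b p v) (a [^] w (p - l))
      else if x = l then comm (a [^] v l) (spinal_b p w) else \<one>)"
proof -
  have lp: "l \<in> {1..p}" using l by auto
  have pl: "wrap p (int p - int l) = p - l"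
    using wrap_of_nat [of "p - l" p] l by (auto simp: of_nat_diff)
  have "comm (spinal v x) (spinal w (wrap p (int x - int l))) =
      (if x = p then comm (spinal_b p v) (a [^] w (p - l))
       else if x = l then comm (a [^] v l) (spinal_b p w) else \<one>)" if x: "x \<in> {1..p}" for x
  proof -
    consider "x = p" | "x = l" | "x \<noteq> p" "x \<noteq> l" by blast
    then show ?thesis
    proof cases
      case 1
      have "p - l \<noteq> p" using l by auto
      then show ?thesis using 1 pl by (simp add: spinal_neq_p)
    next
      case 2
      moreover have "l \<noteq> p" "wrap p (int l - int l) = p" using l p_pos wrap_eq_p_iff [OF p_pos, of 0] by auto
      ultimately show ?thesis by (simp add: spinal_neq_p)
    next
      case 3
      have "wrap p (int x - int l) \<noteq> p" using wrap_diff_eq_p_iff [OF x lp] 3 by blast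
      then show ?thesis using 3 by (simp add: spinal_neq_p)
    qed
  qed
  then have "tup (\<lambda>x. comm (spinal v x) (spinal w (wrap p (int x - int l)))) =
      tup (\<lambda>x. if x = p then comm (spinal_b p v) (a [^] w (p - l))
        else if x = l then comm (a [^] v l) (spinal_b p w) else \<one>)"
    by (rule tup_cong)
  moreover have "comm (spinal_b p v) (spinal_conj w (int l)) =
      tup (\<lambda>x. comm (spinal v x) (spinal w (wrap p (int x - int l))))"
    unfolding spinal_b_eq_tup [of v] spinal_conj_def
    by (rule tup_comm [OF spinal_closed tup_shift_closed [OF spinal_closed]])
  ultimately show ?thesis by simp
qed

end

section \<open>Self-similarity of multi-edge spinal groups\<close>

locale multi_edge = regular_tree +
  fixes r :: nat and E :: "nat \<Rightarrow> nat \<Rightarrow> int"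
  assumes prime_p: "Factorial_Ring.prime p" and odd_p: "odd p"
    and r_pos: "1 \<le> r" and indep: "indep_mod p r E"
begin

definition gens :: "(nat list \<Rightarrow> nat list) set" where
  "gens = insert a ((\<lambda>i. spinal_b p (E i)) ` {1..r})"

abbreviation "G \<equiv> generate A gens"

lemma gens_closed: "gens \<subseteq> carrier A"
  by (auto simp: gens_def)

lemma subgroup_G: "subgroup G A"
  by (rule generate_is_subgroup [OF gens_closed])

lemma a_mem_G: "a \<in> G"
  by (auto simp: gens_def intro: generate.incl)

lemma b_mem_G: "i \<in> {1..r} \<Longrightarrow> spinal_b p (E i) \<in> G"
  by (auto simp: gens_def intro: generate.incl)

lemma spinal_mem_G: "spinal_b p e \<in> G \<Longrightarrow> spinal e x \<in> G"
  using subgroup_int_pow_closed [OF subgroup_G a_mem_G] by (simp add: spinal_def)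

lemma p_ge_3: "3 \<le> p"
  using prime_ge_2_nat [OF prime_p] odd_p by (cases "p = 2") auto

lemma exists_nonzero_entry:
  assumes "i \<in> {1..r}"
  obtains j where "j \<in> {1..p - 1}" "\<not> int p dvd E i j"
proof -
  define c :: "nat \<Rightarrow> int" where "c k = (if k = i then 1 else 0)" for k
  have "(\<Sum>k = 1..r. c k * E k j) = E i j" for j
    using assms by (simp add: c_def if_distrib [of "\<lambda>x. x * _"] cong: if_cong)
  moreover have "\<not> [c i = 0] (mod int p)"
    using p_ge_3 zdvd_imp_le [of "int p" 1] by (auto simp: c_def cong_0_iff)
  ultimately show thesis
    using indep assms that unfolding indep_mod_def by (metis cong_0_iff)
qed

text \<open>The elements of this form are closed under the group operations, since powers of
  \<open>a\<close> only permute coordinates, and they include the generators, whose sections lie in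
  \<open>G\<close>.\<close>

lemma G_decomp:
  assumes "g \<in> G"
  shows "\<exists>f\<in>{1..p} \<rightarrow> G. \<exists>k :: int. g = tup f \<otimes> a [^] k"
proof -
  let ?D = "{g. \<exists>f\<in>{1..p} \<rightarrow> G. \<exists>k :: int. g = tup f \<otimes> a [^] k}"
  have GA: "f \<in> {1..p} \<rightarrow> carrier A" if "f \<in> {1..p} \<rightarrow> G" for f
    using that subgroup.mem_carrier [OF subgroup_G] by auto
  have tc: "tup f \<in> carrier A" if "f \<in> {1..p} \<rightarrow> G" for f using tup_closed [OF GA [OF that]] .
  have "subgroup ?D A"
  proof (rule subgroupI)
    show "?D \<subseteq> carrier A" using tc by auto
    have "tup (\<lambda>x. \<one>) \<otimes> a [^] (0 :: int) \<in> ?D" using subgroup.one_closed [OF subgroup_G] by blast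
    then show "?D \<noteq> {}" by blast
    show "inv g \<in> ?D" if g: "g \<in> ?D" for g
    proof -
      obtain f and k :: int where f: "f \<in> {1..p} \<rightarrow> G" "g = tup f \<otimes> a [^] k" using g by blast
      let ?f = "\<lambda>x. inv (f x)"
      have f': "?f \<in> {1..p} \<rightarrow> G" using f(1) subgroup.m_inv_closed [OF subgroup_G] by auto
      have "inv g = a [^] (- k) \<otimes> tup ?f"
        using f(2) tc [OF f(1)] tup_inv [OF GA [OF f(1)]] by (simp add: inv_mult_group int_pow_neg)
      also have "\<dots> = inv (a [^] k) \<otimes> tup ?f \<otimes> a [^] k \<otimes> a [^] (- k)"
        using tc [OF f'] by (simp add: m_assoc a_pow_mult int_pow_neg)
      also have "\<dots> = tup (\<lambda>x. ?f (wrap p (int x - k))) \<otimes> a [^] (- k)"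
        using tup_conj_a_pow [OF GA [OF f'], of k] by simp
      finally show ?thesis using tup_shift_closed [OF f', of "\<lambda>x. int x - k"] by blast
    qed
    show "g \<otimes> h \<in> ?D" if g: "g \<in> ?D" and h: "h \<in> ?D" for g h
    proof -
      obtain f and k :: int where f: "f \<in> {1..p} \<rightarrow> G" "g = tup f \<otimes> a [^] k" using g by blast
      obtain f' and k' :: int where f': "f' \<in> {1..p} \<rightarrow> G" "h = tup f' \<otimes> a [^] k'" using h by blast
      let ?f' = "\<lambda>x. f' (wrap p (int x - - k))"
      have sh: "?f' \<in> {1..p} \<rightarrow> G" by (rule tup_shift_closed [OF f'(1)])
      have "a [^] k \<otimes> tup f' = tup ?f' \<otimes> a [^] k"
      proof -
        have "tup ?f' = a [^] k \<otimes> tup f' \<otimes> a [^] (- k)"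
          using tup_conj_a_pow [OF GA [OF f'(1)], of "- k"] by (simp add: int_pow_neg)
        then show ?thesis using tc [OF f'(1)] by (simp add: m_assoc a_pow_mult)
      qed
      then have "a [^] k \<otimes> (tup f' \<otimes> a [^] k') = tup ?f' \<otimes> a [^] (k + k')"
        using tc [OF f'(1)] tc [OF sh] by (simp add: m_assoc [symmetric] a_pow_mult [symmetric])
      then have "g \<otimes> h = tup (\<lambda>x. f x \<otimes> ?f' x) \<otimes> a [^] (k + k')"
        using f(2) f'(2) tc [OF f'(1)] tc [OF f(1)] tc [OF sh] tup_mult [of f ?f', symmetric]
        by (simp add: m_assoc)
      moreover have "(\<lambda>x. f x \<otimes> ?f' x) \<in> {1..p} \<rightarrow> G"
        using f(1) sh subgroup.m_closed [OF subgroup_G] by (simp add: Pi_iff)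
      ultimately show ?thesis by blast
    qed
  qed
  moreover have "gens \<subseteq> ?D"
  proof -
    have "a = tup (\<lambda>x. \<one>) \<otimes> a [^] (1 :: int)" by (simp add: int_pow_1)
    then have "a \<in> ?D" using subgroup.one_closed [OF subgroup_G] by blast
    moreover have "spinal_b p (E i) \<in> ?D" if "i \<in> {1..r}" for i
    proof -
      have "spinal_b p (E i) = tup (spinal (E i)) \<otimes> a [^] (0 :: int)"
        using spinal_b_closed [of "E i"] by (simp add: spinal_b_eq_tup)
      then show ?thesis using spinal_mem_G [OF b_mem_G [OF that]] by blast
    qed
    ultimately show ?thesis by (auto simp: gens_def)
  qed
  ultimately show ?thesis using generate_subset_subgroup assms by blast
qed

lemma spinal_conj_mem_G: "spinal_b p e \<in> G \<Longrightarrow> spinal_conj e k \<in> G"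
  unfolding spinal_conj_eq using subgroup_int_pow_closed [OF subgroup_G a_mem_G]
  by (intro subgroup.m_closed [OF subgroup_G] subgroup.m_inv_closed [OF subgroup_G]) auto

text \<open>The possible sections at \<open>p\<close> form a subgroup. It contains
  \<open>b_i\<close>, the section of \<open>b_i\<close> itself, and a nontrivial power of
  \<open>a\<close>, read off a conjugate of \<open>b_1\<close>.\<close>

lemma G_stab_onto:
  assumes "u \<in> G"
  shows "\<exists>f\<in>{1..p} \<rightarrow> G. tup f \<in> G \<and> f p = u"
proof -
  let ?U = "{u. \<exists>f\<in>{1..p} \<rightarrow> G. tup f \<in> G \<and> f p = u}"
  have GA: "f \<in> {1..p} \<rightarrow> carrier A" if "f \<in> {1..p} \<rightarrow> G" for f
    using that subgroup.mem_carrier [OF subgroup_G] by auto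
  have U: "subgroup ?U A"
  proof (rule subgroupI)
    show "?U \<subseteq> carrier A" using GA p_pos by fastforce
    have "\<one> \<in> ?U" using subgroup.one_closed [OF subgroup_G] by (intro CollectI bexI [of _ "\<lambda>x. \<one>"]) auto
    then show "?U \<noteq> {}" by blast
    show "inv g \<in> ?U" if g: "g \<in> ?U" for g
    proof -
      obtain f where f: "f \<in> {1..p} \<rightarrow> G" "tup f \<in> G" "f p = g" using g by blast
      have "tup (\<lambda>x. inv (f x)) \<in> G"
        using subgroup.m_inv_closed [OF subgroup_G f(2)] tup_inv [OF GA [OF f(1)]] by simp
      then show ?thesis
        using f subgroup.m_inv_closed [OF subgroup_G] by (intro CollectI bexI [of _ "\<lambda>x. inv (f x)"]) auto
    qed
    show "g \<otimes> h \<in> ?U" if g: "g \<in> ?U" and h: "h \<in> ?U" for g h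
    proof -
      obtain f where f: "f \<in> {1..p} \<rightarrow> G" "tup f \<in> G" "f p = g" using g by blast
      obtain f' where f': "f' \<in> {1..p} \<rightarrow> G" "tup f' \<in> G" "f' p = h" using h by blast
      have "tup (\<lambda>x. f x \<otimes> f' x) \<in> G"
        using subgroup.m_closed [OF subgroup_G f(2) f'(2)] by (simp add: tup_mult)
      moreover have "(\<lambda>x. f x \<otimes> f' x) \<in> {1..p} \<rightarrow> G"
        using f(1) f'(1) subgroup.m_closed [OF subgroup_G] by (simp add: Pi_iff)
      ultimately show ?thesis using f(3) f'(3) by (intro CollectI bexI [of _ "\<lambda>x. f x \<otimes> f' x"]) auto
    qed
  qed
  have b: "spinal_b p (E i) \<in> ?U" if "i \<in> {1..r}" for i
    using b_mem_G [OF that] spinal_mem_G [OF b_mem_G [OF that]]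
    by (intro CollectI bexI [of _ "spinal (E i)"]) (auto simp: spinal_b_eq_tup [symmetric])
  have one: "1 \<in> {1..r}" using r_pos by simp
  obtain j where j: "j \<in> {1..p - 1}" "\<not> int p dvd E 1 j" using exists_nonzero_entry [OF one] .
  have "a [^] E 1 j \<in> ?U"
  proof -
    \<comment> \<open>Conjugation by \<open>a^(p - j)\<close> brings the vertex \<open>j\<close> to
      \<open>p\<close>, where the section becomes \<open>a^(E 1 j)\<close>.\<close>
    let ?f = "\<lambda>x. spinal (E 1) (wrap p (int x - (int p - int j)))"
    have jp: "j \<in> {1..p}" "j \<noteq> p" using j(1) by auto
    have "?f \<in> {1..p} \<rightarrow> G" using spinal_mem_G [OF b_mem_G [OF one]] by blast
    moreover have "tup ?f \<in> G" using spinal_conj_mem_G [OF b_mem_G [OF one]] by (simp add: spinal_conj_def)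
    moreover have "?f p = a [^] E 1 j" using wrap_of_nat [OF jp(1)] jp(2) by (simp add: spinal_neq_p)
    ultimately show ?thesis by blast
  qed
  then have "a \<in> ?U" using a_mem_of_pow [OF U prime_p _ j(2)] by blast
  then have "gens \<subseteq> ?U" using b by (auto simp: gens_def)
  then show ?thesis using generate_subset_subgroup [OF U] assms by blast
qed

sublocale self_similar A p G
  by (intro self_similar.intro self_similar_axioms.intro regular_tree_axioms subgroup_G a_mem_G G_decomp G_stab_onto)

end

section \<open>Rank at least two\<close>

context multi_edge
begin

text \<open>The product of the \<open>b_i ^ c i\<close>, written as one spinal automorphism so that
  relations in the span become linear algebra modulo \<open>p\<close>.\<close>

definition combo :: "(nat \<Rightarrow> int) \<Rightarrow> nat list \<Rightarrow> nat list" where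
  "combo c = spinal_b p (\<lambda>j. \<Sum>i = 1..r. c i * E i j)"

lemma combo_closed [simp, intro]: "combo c \<in> carrier A"
  by (simp add: combo_def)

lemma combo_mult: "combo c \<otimes> combo c' = combo (\<lambda>i. c i + c' i)"
  by (simp add: combo_def spinal_b_add sum.distrib algebra_simps)

lemma combo_pow: "combo c [^] (k :: int) = combo (\<lambda>i. k * c i)"
  by (simp add: combo_def spinal_b_pow sum_distrib_left mult.assoc)

lemma combo_cong: "(\<And>i. i \<in> {1..r} \<Longrightarrow> [c i = c' i] (mod int p)) \<Longrightarrow> combo c = combo c'"
  unfolding combo_def by (intro spinal_b_cong cong_sum cong_scalar_right) auto

lemma combo_unit:
  assumes "i \<in> {1..r}"
  shows "combo (\<lambda>k. if k = i then 1 else 0) = spinal_b p (E i)"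
  using assms by (simp add: combo_def if_distrib [of "\<lambda>x. x * _"] cong: if_cong)

lemma combo_mem_G: "combo c \<in> G"
proof -
  have "spinal_b p (\<lambda>j. \<Sum>i = 1..n. c i * E i j) \<in> G" if "n \<le> r" for n
    using that
  proof (induction n)
    case 0
    then show ?case using subgroup.one_closed [OF subgroup_G] by (simp add: spinal_b_zero)
  next
    case (Suc n)
    have "spinal_b p (\<lambda>j. \<Sum>i = 1..Suc n. c i * E i j) =
        spinal_b p (\<lambda>j. \<Sum>i = 1..n. c i * E i j) \<otimes> spinal_b p (E (Suc n)) [^] c (Suc n)"
      by (simp add: spinal_b_pow spinal_b_add)
    moreover have "spinal_b p (E (Suc n)) [^] c (Suc n) \<in> G"
      using Suc.prems by (intro subgroup_int_pow_closed [OF subgroup_G] b_mem_G) simp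
    ultimately show ?case using Suc subgroup.m_closed [OF subgroup_G] by simp
  qed
  then show ?thesis by (simp add: combo_def)
qed

lemma subgroup_combo: "subgroup (range combo) A"
proof (rule subgroupI)
  show "inv g \<in> range combo" if g: "g \<in> range combo" for g
  proof -
    obtain c where "g = combo c" using g by blast
    then have "inv g = combo (\<lambda>i. - 1 * c i)"
      using combo_pow [of c "- 1"] by (simp add: int_pow_neg int_pow_1)
    then show ?thesis by blast
  qed
  show "g \<otimes> h \<in> range combo" if "g \<in> range combo" "h \<in> range combo" for g h
    using that by (auto simp: combo_mult)
qed auto

lemma finite_combo: "finite (range combo)"
proof (rule finite_subset)
  show "range combo \<subseteq> combo ` (PiE {1..r} (\<lambda>_. {0..<int p}))"
  proof
    fix g assume "g \<in> range combo"
    then obtain c where "g = combo c" by blast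
    moreover have "combo c = combo (restrict (\<lambda>i. c i mod int p) {1..r})"
      by (intro combo_cong) (simp add: cong_def)
    moreover have "restrict (\<lambda>i. c i mod int p) {1..r} \<in> PiE {1..r} (\<lambda>_. {0..<int p})"
      using p_pos by auto
    ultimately show "g \<in> combo ` (PiE {1..r} (\<lambda>_. {0..<int p}))" by blast
  qed
qed (intro finite_imageI finite_PiE; simp)

lemma subgroup_range_int_pow: "x \<in> carrier A \<Longrightarrow> subgroup (range (\<lambda>k :: int. x [^] k)) A"
proof (rule subgroupI)
  assume x: "x \<in> carrier A"
  show "inv g \<in> range (\<lambda>k :: int. x [^] k)" if "g \<in> range (\<lambda>k :: int. x [^] k)" for g
    using that x by (auto simp: int_pow_neg [symmetric])
  show "g \<otimes> h \<in> range (\<lambda>k :: int. x [^] k)"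
    if "g \<in> range (\<lambda>k :: int. x [^] k)" "h \<in> range (\<lambda>k :: int. x [^] k)" for g h
    using that x by (auto simp: int_pow_mult [symmetric])
qed auto

lemma range_a_pow_eq: "range (\<lambda>k :: int. a [^] k) = (\<lambda>k :: int. a [^] k) ` {0..<int p}"
proof -
  have "a [^] k \<in> (\<lambda>k :: int. a [^] k) ` {0..<int p}" for k :: int
    using p_pos by (intro image_eqI [of _ _ "k mod int p"] a_pow_cong) (simp_all add: cong_def)
  then show ?thesis by blast
qed

lemma comm_mem_G: "x \<in> G \<Longrightarrow> y \<in> G \<Longrightarrow> comm x y \<in> G"
  unfolding comm_def by (intro subgroup.m_closed [OF subgroup_G] subgroup.m_inv_closed [OF subgroup_G])

text \<open>\<open>G/N\<close> is abelian and generated by the images of two finite groups,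
  \<open>range combo\<close> and the powers of \<open>a\<close>. Commutativity makes
  \<open>N\<close> times the first normal, so its product with the second is a subgroup, hence all
  of \<open>G\<close>.\<close>

lemma finite_cover_of_comm:
  assumes N: "normal_in N G" and ab: "\<And>x y. x \<in> G \<Longrightarrow> y \<in> G \<Longrightarrow> comm x y \<in> N"
  shows "finite_cover N G"
proof (rule finite_cover_trans [where Q = "range combo"])
  let ?N = "N <#> range combo" and ?C = "range (\<lambda>k :: int. a [^] k)"
  have sub: "range combo \<subseteq> G" using combo_mem_G by blast
  note N1 = normal_inD(1) [OF N]
  show "subgroup N A" by (rule N1)
  show "range combo \<subseteq> carrier A" by auto
  show "finite_cover N (range combo)"
    by (intro finite_cover_set_mult [OF N1 finite_combo] subset_set_mult [OF N1 subgroup_combo]) auto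
  have N': "normal_in ?N G"
    using sub by (intro normal_in_set_mult [OF N subgroup_G subgroup_combo]) (auto intro!: ab)
  have C: "subgroup ?C A" "?C \<subseteq> G" using subgroup_range_int_pow a_pow_in_G by auto
  have NC: "subgroup (?N <#> ?C) A" by (rule subgroup_normal_set_mult [OF N' subgroup_G C])
  have "gens \<subseteq> ?N <#> ?C"
  proof -
    have "a \<in> ?C" by (rule image_eqI [of _ _ 1]) (simp_all add: int_pow_1)
    then have "a \<in> ?N <#> ?C" using subset_set_mult(2) [OF normal_inD(1) [OF N'] C(1)] by blast
    moreover have "spinal_b p (E i) \<in> ?N <#> ?C" if "i \<in> {1..r}" for i
    proof -
      have "spinal_b p (E i) \<in> range combo" using combo_unit [OF that] by (metis rangeI)
      then have "spinal_b p (E i) \<in> ?N" using subset_set_mult(2) [OF N1 subgroup_combo] by blast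
      then show ?thesis using subset_set_mult(1) [OF normal_inD(1) [OF N'] C(1)] by blast
    qed
    ultimately show ?thesis by (auto simp: gens_def)
  qed
  then have "G \<subseteq> ?N <#> ?C" using generate_subset_subgroup [OF NC] by blast
  moreover have "finite ?C" unfolding range_a_pow_eq by simp
  ultimately show "finite_cover ?N G"
    using normal_inD(1) [OF N'] by (intro finite_cover_set_mult) auto
qed

text \<open>Only the set; the derived subgroup is its normal hull. Invariance under conjugation is
  all that \<open>normal_in_centralizing\<close> asks of it.\<close>

definition commutators :: "(nat list \<Rightarrow> nat list) set" where
  "commutators = {comm x y | x y. x \<in> G \<and> y \<in> G}"

lemma commutators_subset: "commutators \<subseteq> G"
  by (auto simp: commutators_def intro: comm_mem_G)

lemma commutators_conj: "y \<in> commutators \<Longrightarrow> u \<in> G \<Longrightarrow> inv u \<otimes> y \<otimes> u \<in> commutators"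
proof -
  assume "y \<in> commutators" "u \<in> G"
  then obtain x z where xz: "x \<in> G" "z \<in> G" "y = comm x z" by (auto simp: commutators_def)
  then have "inv u \<otimes> y \<otimes> u = comm (inv u \<otimes> x \<otimes> u) (inv u \<otimes> z \<otimes> u)"
    using conj_comm [of x z u] G_carrier \<open>u \<in> G\<close> by simp
  moreover have "inv u \<otimes> x \<otimes> u \<in> G" "inv u \<otimes> z \<otimes> u \<in> G"
    using xz \<open>u \<in> G\<close> by (auto intro!: subgroup.m_closed [OF subgroup_G] subgroup.m_inv_closed [OF subgroup_G])
  ultimately show ?thesis unfolding commutators_def by blast
qed

lemma comm_mem_if_a_b:
  assumes N: "normal_in N G" and ab: "\<And>i. i \<in> {1..r} \<Longrightarrow> comm a (spinal_b p (E i)) \<in> N"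
    and "x \<in> G" "y \<in> G"
  shows "comm x y \<in> N"
proof (rule comm_mem_of_generators [OF gens_closed N])
  note N1 = normal_inD(1) [OF N]
  have ba: "comm (spinal_b p (E i)) a \<in> N" if "i \<in> {1..r}" for i
    using ab [OF that] comm_sym_mem [OF N1] by simp
  have bb: "comm (spinal_b p e) (spinal_b p e') \<in> N" for e e'
    using comm_eq_one [OF _ _ spinal_b_commute] subgroup.one_closed [OF N1] by simp
  show "comm s t \<in> N" if "s \<in> gens" "t \<in> gens" for s t
    using that ab ba bb subgroup.one_closed [OF N1] by (auto simp: gens_def)
qed fact+

text \<open>Suppose that the span of the \<open>b_i\<close> is not inside \<open>?X\<close>. For
  active \<open>l\<close> the kernel of the coordinate \<open>F l\<close> lies in \<open>?X\<close>
  (\<open>ker\<close>), and having codimension one it is the whole intersection of the span with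
  \<open>?X\<close> (\<open>all\<close>). So these kernels coincide; a nonzero common element, which
  exists for \<open>r \<ge> 2\<close>, has all coordinates zero, against independence.\<close>

lemma comm_mem_rank_ge_2:
  assumes r2: "2 \<le> r" and K: "normal_in K G"
    and ab: "\<And>x y. x \<in> G \<Longrightarrow> y \<in> G \<Longrightarrow> comm x y \<in> K" and i: "i \<in> {1..r}"
  shows "delta p (comm a (spinal_b p (E i))) \<in> K"
proof -
  let ?M = "{g \<in> G. delta p g \<in> K}"
  let ?X = "{g \<in> G. comm a g \<in> ?M}"
  define F where "F l c = (\<Sum>i = 1..r. c i * E i l)" for l :: nat and c
  have M: "normal_in ?M G" by (rule normal_in_delta [OF K])
  have X: "subgroup ?X A" by (rule subgroup_centralizing [OF M subgroup_G a_closed])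
  \<comment> \<open>That is, the conjugate of some \<open>b_k\<close> by \<open>a^l\<close> has a
    nontrivial section at \<open>p\<close>, namely \<open>a^(E k (p - l))\<close>.\<close>
  define active where "active l \<longleftrightarrow> l \<in> {1..p - 1} \<and> (\<exists>k\<in>{1..r}. \<not> int p dvd E k (p - l))" for l
  \<comment> \<open>If \<open>F l c\<close> vanishes, the commutator with that conjugate has trivial
    section at \<open>l\<close> and equals \<open>delta p [combo c, a^?x]\<close>; as
    \<open>?x\<close> is invertible modulo \<open>p\<close>, \<open>a\<close> may replace
    \<open>a^?x\<close>.\<close>
  have ker: "combo c \<in> ?X" if l: "active l" and c: "int p dvd F l c" for l c
  proof -
    obtain k where k: "k \<in> {1..r}" "\<not> int p dvd E k (p - l)" and l': "l \<in> {1..p - 1}"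
      using l by (auto simp: active_def)
    let ?x = "E k (p - l)"
    have "comm (combo c) (spinal_conj (E k) (int l)) = delta p (comm (combo c) (a [^] ?x))"
      unfolding combo_def F_def [symmetric] comm_spinal_b_spinal_conj [OF l'] delta_def
      using a_pow_eq_one [OF c] by (intro tup_cong) auto
    moreover have "comm (combo c) (spinal_conj (E k) (int l)) \<in> K"
      by (intro ab combo_mem_G spinal_conj_mem_G b_mem_G k)
    ultimately have "comm (combo c) (a [^] ?x) \<in> ?M"
      using comm_mem_G [OF combo_mem_G a_pow_in_G] by simp
    then have "a [^] ?x \<in> {g \<in> G. comm (combo c) g \<in> ?M}" using a_pow_in_G by blast
    then have "a \<in> {g \<in> G. comm (combo c) g \<in> ?M}"
      using a_mem_of_pow [OF subgroup_centralizing [OF M subgroup_G combo_closed] prime_p _ k(2)] by blast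
    then show ?thesis
      using comm_sym_mem [OF normal_inD(1) [OF M]] combo_mem_G by blast
  qed
  \<comment> \<open>\<open>c'\<close> is a multiple of \<open>c\<close> plus a vector
    \<open>c''\<close> in the kernel of \<open>F l\<close>.\<close>
  have all: "combo c' \<in> ?X" if l: "active l" and c: "combo c \<in> ?X" "\<not> int p dvd F l c" for l c c'
  proof -
    obtain y where y: "[F l c * y = 1] (mod int p)" using prime_mult_inverse_int [OF prime_p c(2)] .
    define t where "t = y * F l c'"
    define c'' where "c'' i = c' i - t * c i" for i
    have "F l c'' = F l c' - t * F l c"
      by (simp add: F_def c''_def sum_subtractf sum_distrib_left algebra_simps)
    also have "\<dots> = F l c' * (1 - F l c * y)" by (simp add: t_def algebra_simps)
    finally have "int p dvd F l c''" using y by (simp add: cong_iff_dvd_diff dvd_diff_commute)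
    then have "combo c'' \<in> ?X" by (rule ker [OF l])
    moreover have "combo c [^] t \<in> ?X" by (rule subgroup_int_pow_closed [OF X c(1)])
    ultimately have "combo c'' \<otimes> combo c [^] t \<in> ?X" by (rule subgroup.m_closed [OF X])
    then show ?thesis by (simp add: combo_pow combo_mult c''_def)
  qed
  have "\<exists>c. combo c \<notin> ?X" if "spinal_b p (E i) \<notin> ?X"
    using that by (intro exI [of _ "\<lambda>k. if k = i then 1 else 0"]) (simp only: combo_unit [OF i] not_False_eq_True)
  moreover have False if bad: "combo c0 \<notin> ?X" for c0
  proof -
    have one: "1 \<in> {1..r}" using r2 by simp
    have nd1: "\<not> int p dvd 1" using p_ge_3 zdvd_imp_le [of "int p" 1] by auto
    obtain j where j: "j \<in> {1..p - 1}" "\<not> int p dvd E 1 j" using exists_nonzero_entry [OF one] .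
    define l0 where "l0 = p - j"
    have "p - l0 = j" using j(1) by (auto simp: l0_def)
    then have l0: "active l0" unfolding active_def using j one by (auto simp: l0_def)
    \<comment> \<open>All coordinates vanish on the kernel of \<open>F l0\<close>, so independence
      makes this kernel trivial.\<close>
    have zero: "int p dvd c i" if c: "int p dvd F l0 c" and i: "i \<in> {1..r}" for c i
    proof -
      have "int p dvd F l c" if l: "l \<in> {1..p - 1}" for l
      proof (rule ccontr)
        assume nz: "\<not> int p dvd F l c"
        show False
        proof (cases "active l")
          case True
          then show False using all [OF True ker [OF l0 c] nz] bad by blast
        next
          \<comment> \<open>If \<open>l\<close> is not active, all entries at \<open>p - l\<close>
            vanish. Since \<open>F l c\<close> does not, \<open>p - l\<close> is active, and
            \<open>F (p - l) = 0\<close> puts the whole span into \<open>?X\<close>.\<close>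
          case False
          then have z: "int p dvd E k (p - l)" if "k \<in> {1..r}" for k
            using l that by (auto simp: active_def)
          have "\<exists>k\<in>{1..r}. \<not> int p dvd E k l"
            using nz unfolding F_def by (meson dvd_mult dvd_sum)
          moreover have "p - (p - l) = l" "p - l \<in> {1..p - 1}" using l by auto
          ultimately have "active (p - l)" by (simp add: active_def)
          moreover have "int p dvd F (p - l) c0" unfolding F_def by (intro dvd_sum dvd_mult z)
          ultimately show False using ker bad by blast
        qed
      qed
      then show ?thesis using indep i unfolding indep_mod_def F_def cong_0_iff by blast
    qed
    have F2: "F l0 (\<lambda>i. if i = 1 then x else if i = 2 then y else 0) = x * E 1 l0 + y * E 2 l0" for x y
    proof -
      have "F l0 (\<lambda>i. if i = 1 then x else if i = 2 then y else 0) =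
          (\<Sum>i\<in>{1, 2}. (if i = 1 then x else if i = 2 then y else 0) * E i l0)"
        unfolding F_def using r2 by (intro sum.mono_neutral_right) auto
      then show ?thesis by simp
    qed
    \<comment> \<open>The vector \<open>(E 2 l0, - E 1 l0)\<close> lies in the kernel of
      \<open>F l0\<close>, so both entries vanish modulo \<open>p\<close>; but then the first unit
      vector is in the kernel too, which is absurd.\<close>
    have "int p dvd E 2 l0" "int p dvd - E 1 l0"
      using zero [of "\<lambda>i. if i = 1 then E 2 l0 else if i = 2 then - E 1 l0 else 0" 1]
        zero [of "\<lambda>i. if i = 1 then E 2 l0 else if i = 2 then - E 1 l0 else 0" 2] F2 r2 by auto
    then have "int p dvd F l0 (\<lambda>i. if i = 1 then 1 else if i = 2 then 0 else 0)" unfolding F2 by simp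
    then show False using zero [OF _ one] nd1 by fastforce
  qed
  ultimately show ?thesis by blast
qed

lemma branch_rank_ge_2:
  assumes r2: "2 \<le> r"
  shows "branch_group (A\<lparr>carrier := G\<rparr>)"
proof (rule branch_group_if_delta_closed)
  let ?K = "normal_hull G commutators"
  show K: "normal_in ?K G" by (rule normal_in_normal_hull [OF subgroup_G commutators_subset])
  have ab: "comm x y \<in> ?K" if "x \<in> G" "y \<in> G" for x y
    using that normal_hull_superset [of commutators G] by (auto simp: commutators_def)
  show "finite_cover ?K G" by (rule finite_cover_of_comm [OF K ab])
  let ?M = "{g \<in> G. delta p g \<in> ?K}"
  have M: "normal_in ?M G" by (rule normal_in_delta [OF K])
  have "comm a (spinal_b p (E i)) \<in> ?M" if "i \<in> {1..r}" for i
    using comm_mem_rank_ge_2 [OF r2 K ab that] comm_mem_G [OF a_mem_G b_mem_G [OF that]] by blast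
  then have "commutators \<subseteq> ?M" using comm_mem_if_a_b [OF M] by (auto simp: commutators_def)
  then show "delta p g \<in> ?K" if "g \<in> ?K" for g
    using normal_hull_least [OF M] that by blast
qed (use p_ge_3 in simp)

end

section \<open>Rank one\<close>

locale rank_one = multi_edge +
  assumes r_one: "r = 1"
begin

abbreviation "e \<equiv> E 1"
abbreviation "b \<equiv> spinal_b p (E 1)"

definition triple_commutators :: "(nat list \<Rightarrow> nat list) set" where
  "triple_commutators = {comm (comm x y) z | x y z. x \<in> G \<and> y \<in> G \<and> z \<in> G}"

definition K where "K = normal_hull G triple_commutators"
definition M where "M = {g \<in> G. delta p g \<in> K}"
text \<open>The centralizer modulo \<open>M\<close> of all commutators; once it contains
  \<open>a\<close> and \<open>b\<close>, \<open>K \<subseteq> M\<close> follows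
  (\<open>K_subset_M\<close>).\<close>

definition Z where "Z = {g \<in> G. \<forall>y\<in>commutators. comm y g \<in> M}"

lemma gens_eq: "gens = {a, b}"
  unfolding gens_def by (simp add: r_one)

lemma b_in_G: "b \<in> G"
  using b_mem_G r_one by simp

lemma normal_K: "normal_in K G"
  unfolding K_def by (rule normal_in_normal_hull [OF subgroup_G])
    (auto simp: triple_commutators_def intro: comm_mem_G)

lemma triple_mem_K: "x \<in> G \<Longrightarrow> y \<in> G \<Longrightarrow> z \<in> G \<Longrightarrow> comm (comm x y) z \<in> K"
  using normal_hull_superset [of triple_commutators G] by (auto simp: triple_commutators_def K_def)

lemma normal_M: "normal_in M G"
  unfolding M_def by (rule normal_in_delta [OF normal_K])

lemma normal_Z: "normal_in Z G"
  unfolding Z_def using commutators_subset G_carrier commutators_conj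
  by (intro normal_in_centralizing [OF normal_M subgroup_G]) auto

lemma comm_mem_if_c:
  assumes N: "normal_in N G" and c: "comm b a \<in> N" and "x \<in> G" "y \<in> G"
  shows "comm x y \<in> N"
  using comm_mem_if_a_b [OF N _ assms(3,4)] c comm_sym_mem [OF normal_inD(1) [OF N]] r_one by simp

text \<open>Modulo \<open>K\<close> the element \<open>c = [b, a]\<close> is central and
  \<open>[b, a^n] = c^n\<close>; with \<open>a^p = 1\<close> this gives \<open>c^p \<in> K\<close>.
  So \<open>c\<close> generates a finite central subgroup modulo \<open>K\<close>, and the quotient
  by it is abelian.\<close>

lemma finite_cover_K: "finite_cover K G"
proof (rule finite_cover_trans)
  let ?c = "comm b a"
  let ?Q = "range (\<lambda>k :: int. ?c [^] k)"
  note K1 = normal_inD(1) [OF normal_K]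
  have cG: "?c \<in> G" by (rule comm_mem_G [OF b_in_G a_mem_G])
  have cA: "?c \<in> carrier A" by simp
  have Q: "subgroup ?Q A" by (rule subgroup_range_int_pow [OF cA])
  have QG: "?Q \<subseteq> G" using subgroup_int_pow_closed [OF subgroup_G cG] by auto
  show "subgroup K A" by (rule K1)
  show "?Q \<subseteq> carrier A" using cA by auto
  have pow: "\<exists>k\<in>K. comm b (a [^] n) = ?c [^] n \<otimes> k" for n :: nat
  proof (induction n)
    case 0
    then show ?case using subgroup.one_closed [OF K1] by (intro bexI [of _ \<one>]) auto
  next
    case (Suc n)
    then obtain k where k: "k \<in> K" "comm b (a [^] n) = ?c [^] n \<otimes> k" by blast
    let ?y = "comm b (a [^] n)"
    have kA: "k \<in> carrier A" using subgroup.mem_carrier [OF K1 k(1)] .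
    have an: "a [^] n \<in> G" using a_pow_in_G [of "int n"] by (simp add: int_pow_int)
    \<comment> \<open>The new factor is \<open>y^a = y [y, a]\<close> with
      \<open>y = [b, a^n]\<close>, which differs from \<open>y\<close> by a triple
      commutator.\<close>
    have "comm b (a [^] Suc n) = ?c \<otimes> (?y \<otimes> comm ?y a)"
      by (simp add: comm_mult_right mult_comm_right)
    also have "\<dots> = ?c [^] Suc n \<otimes> (k \<otimes> comm ?y a)"
      unfolding nat_pow_Suc2 [OF cA] using kA cA by (subst k(2)) (simp add: m_assoc)
    finally have "comm b (a [^] Suc n) = ?c [^] Suc n \<otimes> (k \<otimes> comm ?y a)" .
    moreover have "k \<otimes> comm ?y a \<in> K"
      by (intro subgroup.m_closed [OF K1] k triple_mem_K b_in_G an a_mem_G)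
    ultimately show ?case by blast
  qed
  obtain k where k: "k \<in> K" "comm b (a [^] p) = ?c [^] p \<otimes> k" using pow by blast
  have "a [^] p = \<one>" using a_pow_eq_one [of "int p"] by (simp add: int_pow_int)
  then have "?c [^] p \<otimes> k = \<one>" using k(2) by simp
  then have "?c [^] p = inv k"
    using subgroup.mem_carrier [OF K1 k(1)] cA by (intro inv_equality [symmetric]) auto
  then have cp: "?c [^] int p \<in> K"
    using subgroup.m_inv_closed [OF K1 k(1)] by (simp add: int_pow_int)
  show "finite_cover K ?Q"
  proof (rule finite_cover_set_mult [OF K1, of "(\<lambda>k :: int. ?c [^] k) ` {0..<int p}"])
    show "?Q \<subseteq> K <#> (\<lambda>k :: int. ?c [^] k) ` {0..<int p}"
    proof (rule image_subsetI)
      fix k :: int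
      have "?c [^] k = (?c [^] int p) [^] (k div int p) \<otimes> ?c [^] (k mod int p)"
        using cA by (simp add: int_pow_pow int_pow_mult [symmetric])
      moreover have "(?c [^] int p) [^] (k div int p) \<in> K" by (rule subgroup_int_pow_closed [OF K1 cp])
      moreover have "?c [^] (k mod int p) \<in> (\<lambda>k :: int. ?c [^] k) ` {0..<int p}" using p_pos by simp
      ultimately show "?c [^] k \<in> K <#> (\<lambda>k :: int. ?c [^] k) ` {0..<int p}"
        unfolding set_mult_def by blast
    qed
  qed (use cA in auto)
  have central: "comm q h \<in> K" if q: "q \<in> ?Q" and h: "h \<in> G" for q h
  proof -
    have "comm h ?c \<in> K"
      using triple_mem_K [OF b_in_G a_mem_G h] comm_sym_mem [OF K1] G_carrier [OF h] cA by blast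
    then have "?c \<in> {g \<in> G. comm h g \<in> K}" using cG by blast
    then have "q \<in> {g \<in> G. comm h g \<in> K}"
      using q subgroup_int_pow_closed [OF subgroup_centralizing [OF normal_K subgroup_G G_carrier [OF h]]]
      by blast
    then show ?thesis using comm_sym_mem [OF K1] G_carrier h by blast
  qed
  have N: "normal_in (K <#> ?Q) G" by (rule normal_in_set_mult [OF normal_K subgroup_G Q QG central])
  have "?c \<in> ?Q" by (rule image_eqI [of _ _ 1]) (simp_all add: int_pow_1)
  then have "?c \<in> K <#> ?Q" using subset_set_mult [OF K1 Q] by blast
  then show "finite_cover (K <#> ?Q) G" by (rule finite_cover_of_comm [OF N comm_mem_if_c [OF N]])
qed

text \<open>The possible values \<open>f p\<close> form a conjugation-invariant set \<open>H\<close>.  The commutator of \<open>b\<close> with its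
  conjugate by \<open>a ^ l\<close> has only two nontrivial sections, and \<open>tup f\<close> commutes with the one at \<open>l\<close>.
  So \<open>H\<close> centralizes \<open>[b, a ^ x]\<close> modulo \<open>M\<close> for \<open>x = e (p - l)\<close>, and therefore, being
  conjugation-invariant, all commutators.\<close>

lemma coordinate_mem_Z:
  assumes l: "l \<in> {1..p - 1}" and x: "\<not> int p dvd e (p - l)"
    and f: "f \<in> {1..p} \<rightarrow> G" "tup f \<in> G" "int p dvd e l \<or> f l = \<one>"
  shows "f p \<in> Z"
proof -
  define H where "H = {g \<in> G. \<exists>f\<in>{1..p} \<rightarrow> G. tup f \<in> G \<and> (int p dvd e l \<or> f l = \<one>) \<and> f p = g}"
  let ?C = "{g \<in> G. \<forall>h\<in>H. comm h g \<in> M}"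
  have lp: "l \<in> {1..p}" "l \<noteq> p" "p \<in> {1..p}" using l p_pos by auto
  note M1 = normal_inD(1) [OF normal_M]
  have HG: "H \<subseteq> G" by (auto simp: H_def)
  have "inv u \<otimes> g \<otimes> u \<in> H" if g: "g \<in> H" and u: "u \<in> G" for g u
  proof -
    obtain h where h: "h \<in> {1..p} \<rightarrow> G" "tup h \<in> G" "int p dvd e l \<or> h l = \<one>" "h p = g"
      using g unfolding H_def by blast
    obtain w where w: "w \<in> {1..p} \<rightarrow> G" "tup w \<in> G" "w p = u" using stab_onto [OF u] by blast
    let ?h = "\<lambda>x. inv (w x) \<otimes> h x \<otimes> w x"
    have inG: "inv y \<otimes> z \<otimes> y \<in> G" if "y \<in> G" "z \<in> G" for y z
      using that by (intro subgroup.m_closed [OF subgroup_G] subgroup.m_inv_closed [OF subgroup_G])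
    have "?h \<in> {1..p} \<rightarrow> G" using h(1) w(1) inG by (simp add: Pi_iff)
    moreover have "tup ?h \<in> G"
      using tup_conj [OF Pi_G_carrier [OF w(1)], of h] inG [OF w(2) h(2)] by simp
    moreover have "w l \<in> carrier A" using w(1) lp(1) G_carrier by blast
    then have "int p dvd e l \<or> ?h l = \<one>" using h(3) by auto
    moreover have "?h p = inv u \<otimes> g \<otimes> u" using h(4) w(3) by simp
    moreover have "inv u \<otimes> g \<otimes> u \<in> G" using inG u g HG by blast
    ultimately show ?thesis unfolding H_def by blast
  qed
  then have C: "normal_in ?C G"
    using HG G_carrier by (intro normal_in_centralizing [OF normal_M subgroup_G]) auto
  let ?y = "comm b (a [^] e (p - l))"
  have yG: "?y \<in> G" by (rule comm_mem_G [OF b_in_G a_pow_in_G])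
  have "comm ?y h \<in> M" if hH: "h \<in> H" for h
  proof -
    obtain w where w: "w \<in> {1..p} \<rightarrow> G" "tup w \<in> G" "int p dvd e l \<or> w l = \<one>" "w p = h"
      using hH unfolding H_def by blast
    let ?v = "\<lambda>x. if x = p then ?y else if x = l then comm (a [^] e l) b else \<one>"
    have wA: "w \<in> {1..p} \<rightarrow> carrier A" by (rule Pi_G_carrier [OF w(1)])
    \<comment> \<open>The section at \<open>l\<close> disappears because \<open>a^(e l) = 1\<close>
      or \<open>w l = 1\<close>.\<close>
    have "comm (comm b (spinal_conj e (int l))) (tup w) = tup (\<lambda>x. comm (?v x) (w x))"
      unfolding comm_spinal_b_spinal_conj [OF l] by (rule tup_comm [OF _ wA]) auto
    also have "\<dots> = delta p (comm ?y h)"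
      unfolding delta_def
    proof (rule tup_cong)
      fix x assume "x \<in> {1..p}"
      then have "w x \<in> carrier A" using wA by blast
      then show "comm (?v x) (w x) = (if x = p then comm ?y h else \<one>)"
        using w(3,4) a_pow_eq_one lp(2) by auto
    qed
    finally have "delta p (comm ?y h) \<in> K"
      using triple_mem_K [OF b_in_G spinal_conj_mem_G [OF b_in_G] w(2)] by metis
    moreover have "comm ?y h \<in> G" using comm_mem_G [OF yG] that HG by blast
    ultimately show ?thesis by (simp add: M_def)
  qed
  then have "?y \<in> ?C" using yG HG G_carrier comm_sym_mem [OF M1] by blast
  \<comment> \<open>The exponent \<open>e (p - l)\<close> is invertible modulo \<open>p\<close>, so
    \<open>a\<close> may replace its power; then \<open>[b, a]\<close> in the normal subgroup
    \<open>?C\<close> brings in all commutators.\<close>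
  then have "a [^] e (p - l) \<in> {g \<in> G. comm b g \<in> ?C}" using a_pow_in_G by blast
  then have "a \<in> {g \<in> G. comm b g \<in> ?C}"
    using a_mem_of_pow [OF subgroup_centralizing [OF C subgroup_G spinal_b_closed] prime_p _ x] by blast
  then have "comm b a \<in> ?C" by blast
  then have C': "commutators \<subseteq> ?C" using comm_mem_if_c [OF C] by (auto simp: commutators_def)
  have fH: "f p \<in> H" using f lp(3) unfolding H_def by blast
  then have fG: "f p \<in> G" using HG by blast
  have "comm y (f p) \<in> M" if y: "y \<in> commutators" for y
  proof -
    have "comm (f p) y \<in> M" using C' y fH by blast
    moreover have "y \<in> G" using y commutators_subset by blast
    ultimately show ?thesis using comm_sym_mem [OF M1 G_carrier [OF fG] G_carrier] by blast
  qed
  then show ?thesis using fG by (simp add: Z_def)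
qed

section \<open>Exponents at indices modulo \<open>p\<close>, and the dichotomy\<close>

text \<open>The exponent vector extended with period \<open>p\<close> to all integers. Multiples of
  \<open>p\<close> give \<open>e p\<close>, which is not an entry of the vector; hence the
  nonvanishing assumptions on indices below.\<close>

definition ew :: "int \<Rightarrow> int" where "ew j = e (wrap p j)"

lemma ew_cong: "[i = j] (mod int p) \<Longrightarrow> ew i = ew j"
  unfolding ew_def using wrap_cong by metis

lemma ew_of_nat: "j \<in> {1..p - 1} \<Longrightarrow> ew (int j) = e j"
  using wrap_of_nat [of j p] by (auto simp: ew_def)

lemma wrap_nonzero: "\<not> int p dvd j \<Longrightarrow> wrap p j \<in> {1..p - 1}"
  using wrap_range [OF p_pos, of j] wrap_eq_p_iff [OF p_pos, of j] by auto

lemma ew_wrap: "ew (int (wrap p j) + k) = ew (j + k)" "ew (k - int (wrap p j)) = ew (k - j)"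
  by (intro ew_cong cong_add cong_diff cong_int_wrap [OF p_pos] cong_refl)+

lemma index_nonzero: "j \<in> {1..p - 1} \<Longrightarrow> \<not> int p dvd int j"
proof -
  assume "j \<in> {1..p - 1}"
  then have "0 < j" "j < p" by auto
  then show ?thesis using nat_dvd_not_less by auto
qed

lemma ew_minus:
  assumes "l \<in> {1..p - 1}"
  shows "e (p - l) = ew (- int l)"
proof -
  have "p - l \<in> {1..p - 1}" using assms by auto
  then have "e (p - l) = ew (int (p - l))" using ew_of_nat by simp
  also have "\<dots> = ew (- int l)"
    using assms by (intro ew_cong) (auto simp: cong_iff_dvd_diff of_nat_diff)
  finally show ?thesis .
qed

text \<open>Take powers of \<open>b\<close> and of its conjugate by \<open>a^(-j)\<close>. At
  \<open>l\<close> their sections are powers of \<open>a^(ew l)\<close> and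
  \<open>a^(ew (l + j))\<close> and can be made to cancel; at \<open>p\<close> they are powers of
  \<open>b\<close> and \<open>a^(ew j)\<close>, so \<open>coordinate_mem_Z\<close> yields the
  claim.\<close>

lemma b_a_mem_Z:
  assumes l: "\<not> int p dvd l" and j: "\<not> int p dvd j" and lj: "\<not> int p dvd l + j"
    and x: "\<not> int p dvd ew (- l)"
  shows "b [^] ew (l + j) \<otimes> a [^] (- ew l * ew j) \<in> Z"
proof -
  define l' where "l' = wrap p l"
  define m where "m = wrap p (- j)"
  have l': "l' \<in> {1..p - 1}" and m: "m \<in> {1..p - 1}"
    using wrap_nonzero l j by (simp_all add: l'_def m_def)
  \<comment> \<open>This is where \<open>l + j\<close> must be nonzero: the conjugate then has a
    power of \<open>a\<close>, not \<open>b\<close>, as its section at \<open>l'\<close>.\<close>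
  have "l' \<noteq> m" using wrap_eq_iff [OF p_pos, of l "- j"] lj by (simp add: l'_def m_def cong_iff_dvd_diff)
  have lp: "l' \<in> {1..p}" "m \<in> {1..p}" "l' \<noteq> p" "m \<noteq> p" "p \<in> {1..p}" using l' m by auto
  have el: "e l' = ew l" by (simp add: ew_def l'_def)
  have epl: "e (p - l') = ew (- l)"
    using ew_minus [OF l'] ew_wrap(2) [of 0 l] by (simp add: l'_def)
  define w where "w = (\<lambda>x. spinal e (wrap p (int x - int m)))"
  have wG: "w x \<in> G" for x using spinal_mem_G [OF b_in_G] by (simp add: w_def)
  have wl: "w l' = a [^] ew (l + j)"
  proof -
    have "wrap p (int l' - int m) \<noteq> p" using wrap_diff_eq_p_iff [OF lp(1,2)] \<open>l' \<noteq> m\<close> by blast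
    moreover have "ew (int l' - int m) = ew (l + j)"
      unfolding l'_def m_def by (simp add: ew_wrap(2)) (metis diff_minus_eq_add ew_wrap(1))
    ultimately show ?thesis by (simp add: w_def spinal_neq_p ew_def)
  qed
  have wp: "w p = a [^] ew j"
  proof -
    have "wrap p (int p - int m) \<noteq> p" using wrap_diff_eq_p_iff [OF lp(5,2)] lp(4) by blast
    moreover have "ew (int p - int m) = ew j"
      unfolding m_def ew_wrap(2) by (rule ew_cong) (simp add: cong_iff_dvd_diff)
    ultimately show ?thesis by (simp add: w_def spinal_neq_p ew_def)
  qed
  \<comment> \<open>The exponents are chosen such that \<open>?f l' = a ^ (e l' * ew (l + j) - ew (l + j) * ew l) = \<one>\<close>.\<close>
  let ?f = "\<lambda>x. spinal e x [^] ew (l + j) \<otimes> w x [^] (- ew l)"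
  have pow: "y \<in> G \<Longrightarrow> y [^] (k :: int) \<in> G" for y k by (rule subgroup_int_pow_closed [OF subgroup_G])
  have "?f \<in> {1..p} \<rightarrow> G"
    using spinal_mem_G [OF b_in_G] wG by (auto intro!: subgroup.m_closed [OF subgroup_G] pow)
  moreover have "tup ?f = b [^] ew (l + j) \<otimes> spinal_conj e (int m) [^] (- ew l)"
  proof -
    have "w \<in> {1..p} \<rightarrow> carrier A" using wG G_carrier by blast
    then show ?thesis
      unfolding tup_mult [symmetric] spinal_b_eq_tup spinal_conj_def w_def [symmetric]
      by (simp only: tup_int_pow [OF spinal_closed] tup_int_pow)
  qed
  then have "tup ?f \<in> G"
    using b_in_G spinal_conj_mem_G [OF b_in_G] by (auto intro!: subgroup.m_closed [OF subgroup_G] pow)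
  moreover have "?f l' = \<one>"
    using lp(3) el by (simp add: wl spinal_neq_p int_pow_pow a_pow_mult algebra_simps a_pow_eq_one)
  ultimately have "?f p \<in> Z" using coordinate_mem_Z [OF l', of ?f] x epl by simp
  then show ?thesis by (simp add: wp int_pow_pow mult.commute)
qed

text \<open>The condition at \<open>l\<close> in \<open>coordinate_mem_Z\<close> holds through its
  first alternative, so any tuple in \<open>G\<close> with section \<open>u\<close> at
  \<open>p\<close> may be used.\<close>

lemma all_mem_Z:
  assumes l: "\<not> int p dvd l" and x: "\<not> int p dvd ew (- l)" and y: "int p dvd ew l" and u: "u \<in> G"
  shows "u \<in> Z"
proof -
  define l' where "l' = wrap p l"
  have l': "l' \<in> {1..p - 1}" using wrap_nonzero l by (simp add: l'_def)
  have "e (p - l') = ew (- l)" using ew_minus [OF l'] ew_wrap(2) [of 0 l] by (simp add: l'_def)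
  then have x': "\<not> int p dvd e (p - l')" using x by simp
  obtain f where f: "f \<in> {1..p} \<rightarrow> G" "tup f \<in> G" "f p = u" using stab_onto [OF u] by blast
  then show ?thesis using coordinate_mem_Z [OF l' x' f(1,2)] y by (simp add: ew_def l'_def)
qed

text \<open>If \<open>ew\<close> vanishes at some \<open>k\<close> but not at \<open>- k\<close>,
  then \<open>Z = G\<close>. Otherwise the support is symmetric. If then \<open>a \<in> Z\<close>, a
  relation from \<open>b_a_mem_Z\<close> gives \<open>b \<in> Z\<close>; if not, \<open>Z\<close>
  contains no nontrivial power of \<open>a\<close>, and comparing exponents yields the law required
  by \<open>constant_of_multiplicative\<close>.\<close>

lemma Z_or_constant:
  "(a \<in> Z \<and> b \<in> Z) \<or> (\<exists>s. \<not> int p dvd s \<and> (\<forall>j\<in>{1..p - 1}. [e j = s] (mod int p)))"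
proof -
  note Z1 = normal_inD(1) [OF normal_Z]
  have pp: "Factorial_Ring.prime (int p)" using prime_p by simp
  have p2: "\<not> int p dvd 2" using p_ge_3 zdvd_imp_le [of "int p" 2] by auto
  have d2: "\<not> int p dvd 2 * l" if "\<not> int p dvd l" for l
    using prime_dvd_multD [OF pp] p2 that by blast
  obtain j0 where j0: "j0 \<in> {1..p - 1}" "\<not> int p dvd e j0" using exists_nonzero_entry [of 1] r_one by auto
  define l where "l = int j0"
  have l: "\<not> int p dvd l" "\<not> int p dvd ew l"
    using j0(2) index_nonzero [OF j0(1)] ew_of_nat [OF j0(1)] by (simp_all add: l_def)
  consider (asym) k where "\<not> int p dvd k" "\<not> int p dvd ew (- k)" "int p dvd ew k"
    | (sym) "\<And>k. \<not> int p dvd k \<Longrightarrow> \<not> int p dvd ew k \<Longrightarrow> \<not> int p dvd ew (- k)"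
    by (metis dvd_minus_iff minus_minus)
  then show ?thesis
  proof cases
    case asym
    then show ?thesis using all_mem_Z a_mem_G b_in_G by blast
  next
    case sym
    show ?thesis
    proof (cases "a \<in> Z")
      case True
      \<comment> \<open>The choice \<open>j = - 2 l\<close> makes \<open>l + j = - l\<close>, where
        \<open>ew\<close> is nonzero by symmetry.\<close>
      have "\<not> int p dvd - (2 * l)" "\<not> int p dvd l + - (2 * l)" using d2 [OF l(1)] l(1) by auto
      then have "b [^] ew (- l) \<otimes> a [^] (- ew l * ew (- (2 * l))) \<in> Z"
        using b_a_mem_Z [OF l(1) _ _ sym [OF l], of "- (2 * l)"] by simp
      moreover have "a [^] (ew l * ew (- (2 * l))) \<in> Z" by (rule subgroup_int_pow_closed [OF Z1 True])
      ultimately have "b [^] ew (- l) \<otimes> a [^] (- ew l * ew (- (2 * l))) \<otimes> a [^] (ew l * ew (- (2 * l))) \<in> Z"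
        by (rule subgroup.m_closed [OF Z1])
      then have "b [^] ew (- l) \<in> Z" by (simp add: m_assoc a_pow_mult)
      moreover obtain y where y: "[ew (- l) * y = 1] (mod int p)"
        using prime_mult_inverse_int [OF prime_p sym [OF l]] .
      ultimately have "(b [^] ew (- l)) [^] y \<in> Z" using subgroup_int_pow_closed [OF Z1] by blast
      moreover have "(b [^] ew (- l)) [^] y = b"
        using spinal_b_pow_cong [OF y, of e] by (simp add: int_pow_pow int_pow_1)
      ultimately show ?thesis using True by simp
    next
      case False
      have mem: "b [^] ew (k + j) \<otimes> a [^] (- ew k * ew j) \<in> Z"
        if "\<not> int p dvd k" "\<not> int p dvd ew k" "\<not> int p dvd j" "\<not> int p dvd k + j" for k j
        using b_a_mem_Z sym that by blast
      have apow: "int p dvd k" if "a [^] k \<in> Z" for k :: int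
        using a_mem_of_pow [OF Z1 prime_p that] False by blast
      have bmod: "b [^] k = \<one>" if "int p dvd k" for k :: int
        using spinal_b_pow_cong [of k 0 e] that by (simp add: cong_0_iff)
      have bpow: "b [^] k \<in> G" for k :: int by (rule subgroup_int_pow_closed [OF subgroup_G b_in_G])
      \<comment> \<open>Were \<open>ew (k + j)\<close> zero, the relation would place a nontrivial
        power of \<open>a\<close> in \<open>Z\<close>. So the support is closed under sums that are
        nonzero indices.\<close>
      have closed: "\<not> int p dvd ew (k + j)"
        if kj: "\<not> int p dvd k" "\<not> int p dvd ew k" "\<not> int p dvd j" "\<not> int p dvd ew j" "\<not> int p dvd k + j" for k j
      proof
        assume "int p dvd ew (k + j)"
        then have "a [^] (- ew k * ew j) \<in> Z" using mem [OF kj(1,2,3,5)] bmod by simp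
        then have "int p dvd ew k * ew j" using apow by fastforce
        then show False using prime_dvd_multD [OF pp] kj by blast
      qed
      have nl: "\<not> int p dvd int n * l" if "0 < n" "n < p" for n
        using that l prime_dvd_multD [OF pp, of "int n" l] nat_dvd_not_less [of n p] by auto
      have mult_nz: "\<not> int p dvd ew (int (Suc n) * l)" if "Suc n < p" for n
        using that
      proof (induction n)
        case 0
        then show ?case using l by simp
      next
        case (Suc n)
        have "l + int (Suc n) * l = int (Suc (Suc n)) * l" by (simp add: algebra_simps)
        then show ?case
          using closed [OF l nl [of "Suc n"]] nl [of "Suc (Suc n)"] Suc by simp
      qed
      have nz: "\<not> int p dvd ew j" if j: "\<not> int p dvd j" for j
      proof -
        obtain y where y: "[l * y = 1] (mod int p)" using prime_mult_inverse_int [OF prime_p l(1)] .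
        \<comment> \<open>\<open>n\<close> is \<open>j / l\<close> modulo \<open>p\<close>: every
          nonzero index is a multiple of \<open>l\<close> and hence in the support.\<close>
        define n where "n = nat ((y * j) mod int p)"
        have n: "int n = (y * j) mod int p" using p_pos by (simp add: n_def)
        have "[int n * l = y * j * l] (mod int p)" by (simp add: n cong_def mod_mult_left_eq)
        moreover have "[y * j * l = 1 * j] (mod int p)"
          using cong_scalar_right [OF y, of j] by (simp add: mult_ac)
        ultimately have eq: "[int n * l = j] (mod int p)" using cong_trans by fastforce
        have "int n < int p" using n p_pos by simp
        then have "n < p" by simp
        moreover have "n \<noteq> 0"
        proof
          assume "n = 0"
          then show False using eq j by (simp add: cong_iff_dvd_diff)
        qed
        ultimately show ?thesis using mult_nz [of "n - 1"] ew_cong [OF eq] by (cases n) auto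
      qed
      have one: "\<not> int p dvd 1" "\<not> int p dvd 1 + 1" using p2 by (auto dest: dvd_trans)
      obtain y where y: "[ew (1 + 1) * y = 1] (mod int p)"
        using prime_mult_inverse_int [OF prime_p nz [OF one(2)]] .
      \<comment> \<open>For \<open>k = j = 1\<close> the relation says that \<open>b ^ ew 2\<close>
        and \<open>a ^ (ew 1 * ew 1)\<close> agree modulo \<open>Z\<close>; raising to the inverse
        \<open>y\<close> of \<open>ew 2\<close> gives \<open>b = a^s\<close> modulo
        \<open>Z\<close>.\<close>
      define s where "s = ew 1 * ew 1 * y"
      have bs: "b \<otimes> a [^] (- s) \<in> Z"
      proof -
        let ?B = "b [^] ew (1 + 1)" and ?k = "ew 1 * ew 1"
        have "?B \<otimes> inv (a [^] ?k) \<in> Z"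
          using mem [OF one(1) nz [OF one(1)] one] by (simp add: int_pow_neg)
        then have "?B [^] y \<otimes> inv ((a [^] ?k) [^] y) \<in> Z"
          by (intro normal_in_pow_diff [OF normal_Z subgroup_G] bpow a_pow_in_G)
        moreover have "?B [^] y = b"
          using spinal_b_pow_cong [OF y, of e] by (simp add: int_pow_pow int_pow_1)
        ultimately show ?thesis by (simp add: int_pow_neg int_pow_pow s_def)
      qed
      have "[ew k * ew j = s * ew (k + j)] (mod int p)"
        if kj: "\<not> int p dvd k" "\<not> int p dvd j" "\<not> int p dvd k + j" for k j
      proof -
        \<comment> \<open>Modulo \<open>Z\<close>, \<open>b ^ ?u\<close> equals both
          \<open>a ^ (s * ?u)\<close> and \<open>a ^ ?v\<close>; their quotient is a power of
          \<open>a\<close> in \<open>Z\<close>, hence trivial.\<close>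
        let ?u = "ew (k + j)" and ?v = "ew k * ew j"
        have "b [^] ?u \<otimes> inv ((a [^] s) [^] ?u) \<in> Z"
          using bs by (intro normal_in_pow_diff [OF normal_Z subgroup_G] b_in_G a_pow_in_G) (simp add: int_pow_neg)
        then have "inv (b [^] ?u \<otimes> inv ((a [^] s) [^] ?u)) \<otimes> (b [^] ?u \<otimes> a [^] (- ew k * ew j)) \<in> Z"
          by (rule subgroup.m_closed [OF Z1 subgroup.m_inv_closed [OF Z1] mem [OF kj(1) nz [OF kj(1)] kj(2,3)]])
        moreover have "inv (b [^] ?u \<otimes> inv ((a [^] s) [^] ?u)) \<otimes> (b [^] ?u \<otimes> a [^] (- ew k * ew j)) =
            a [^] (s * ?u - ?v)"
          by (simp add: m_assoc inv_mult_group int_pow_pow a_pow_mult)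
        ultimately have "int p dvd s * ?u - ?v" using apow by simp
        then show ?thesis by (simp add: cong_iff_dvd_diff dvd_diff_commute)
      qed
      then have const: "[ew j = s] (mod int p)" if "\<not> int p dvd j" for j
        using constant_of_multiplicative [where e = ew and s = s, OF prime_p odd_p ew_cong nz _ that] by blast
      have "\<not> int p dvd s" using const [OF one(1)] nz [OF one(1)] by (simp add: cong_dvd_iff)
      moreover have "[e j = s] (mod int p)" if "j \<in> {1..p - 1}" for j
        using const [OF index_nonzero [OF that]] ew_of_nat [OF that] by simp
      ultimately show ?thesis by blast
    qed
  qed
qed

text \<open>\<open>Z\<close> contains the generators, so their triple commutators lie in
  \<open>M\<close>, and \<open>triple_comm_mem_of_generators\<close> extends this to
  \<open>G\<close>.\<close>

lemma K_subset_M: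
  assumes "a \<in> Z" "b \<in> Z"
  shows "K \<subseteq> M"
  unfolding K_def
proof (rule normal_hull_least [OF normal_M])
  note M1 = normal_inD(1) [OF normal_M]
  have "comm (comm s t) u \<in> M" if "s \<in> gens" "t \<in> gens" "u \<in> gens" for s t u
  proof -
    have "comm s t \<in> commutators"
      using that a_mem_G b_in_G unfolding gens_eq commutators_def by blast
    moreover have "u \<in> Z" using that(3) assms unfolding gens_eq by blast
    ultimately show ?thesis by (simp add: Z_def)
  qed
  then have "comm (comm x y) z \<in> M" if "x \<in> G" "y \<in> G" "z \<in> G" for x y z
    using triple_comm_mem_of_generators [OF gens_closed normal_M _ that] by blast
  then show "triple_commutators \<subseteq> M" by (auto simp: triple_commutators_def)
qed

text \<open>\<open>b\<close> and the spinal generator of the exceptional group are powers of each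
  other, as \<open>s\<close> is invertible modulo \<open>p\<close>.\<close>

lemma exceptional_if_constant:
  assumes s: "\<not> int p dvd s" and const: "\<And>j. j \<in> {1..p - 1} \<Longrightarrow> [e j = s] (mod int p)"
  shows "G = exceptional_group p"
proof -
  let ?b = "spinal_b p (\<lambda>_. 1)"
  have ex: "exceptional_group p = generate A {a, ?b}" by (simp add: exceptional_group_def A_eq)
  have closed: "{a, ?b} \<subseteq> carrier A" by auto
  have bs: "b = ?b [^] s" unfolding spinal_b_pow using const by (intro spinal_b_cong) simp
  obtain y where y: "[s * y = 1] (mod int p)" using prime_mult_inverse_int [OF prime_p s] .
  have b1: "?b = b [^] y"
    unfolding bs using spinal_b_pow_cong [OF y, of "\<lambda>_. 1"] by (simp add: int_pow_pow int_pow_1)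
  have "?b \<in> G" unfolding b1 by (rule subgroup_int_pow_closed [OF subgroup_G b_in_G])
  then have "generate A {a, ?b} \<subseteq> G"
    using a_mem_G by (intro generate_subgroup_incl [OF _ subgroup_G]) auto
  moreover have "b \<in> generate A {a, ?b}"
    unfolding bs by (intro subgroup_int_pow_closed [OF generate_is_subgroup [OF closed]] generate.incl) simp
  then have "G \<subseteq> generate A {a, ?b}"
    unfolding gens_eq
    by (intro generate_subgroup_incl [OF _ generate_is_subgroup [OF closed]]) (auto intro: generate.incl)
  ultimately show ?thesis using ex by blast
qed

lemma branch_rank_one:
  assumes "G \<noteq> exceptional_group p"
  shows "branch_group (A\<lparr>carrier := G\<rparr>)"
proof (rule branch_group_if_delta_closed)
  show "normal_in K G" by (rule normal_K)
  show "finite_cover K G" by (rule finite_cover_K)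
  have "a \<in> Z \<and> b \<in> Z" using Z_or_constant exceptional_if_constant assms by blast
  then show "delta p g \<in> K" if "g \<in> K" for g
    using K_subset_M that by (auto simp: M_def)
qed (use p_ge_3 in simp)

end

theorem proposition3p7:
  fixes p :: nat and G :: "(nat list \<Rightarrow> nat list) set"
  assumes "Factorial_Ring.prime p" and "odd p"
    and "multi_edge_spinal p G"
    and "\<not> conjugate_in (RegAut p) G (exceptional_group p)"
  shows "branch_group ((RegAut p)\<lparr>carrier := G\<rparr>)"
proof -
  obtain r E where rE: "1 \<le> r" "indep_mod p r E"
    and G: "G = generate (RegAut p) (insert (rooted_a p) ((\<lambda>i. spinal_b p (E i)) ` {1..r}))"
    using assms(3) unfolding multi_edge_spinal_def by blast
  interpret multi_edge "RegAut p" p r E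
  proof (intro multi_edge.intro multi_edge_axioms.intro regular_tree.intro regular_tree_axioms.intro group_AutT)
    show "1 \<le> p" using prime_ge_1_nat [OF assms(1)] .
  qed (use assms rE in auto)
  have G: "G = generate (RegAut p) gens" by (simp only: G gens_def)
  show ?thesis
  proof (cases "r = 1")
    case True
    interpret rank_one "RegAut p" p r E by unfold_locales (rule True)
    \<comment> \<open>Equal subgroups are conjugate by the identity, so the hypothesis excludes
      \<open>G = exceptional_group p\<close>.\<close>
    let ?one = "\<one>\<^bsub>RegAut p\<^esub>"
    have "(\<lambda>h. inv\<^bsub>RegAut p\<^esub> ?one \<otimes>\<^bsub>RegAut p\<^esub> h \<otimes>\<^bsub>RegAut p\<^esub> ?one) ` G = (\<lambda>h. h) ` G"
      using subgroup.mem_carrier [OF subgroup_G] by (intro image_cong) (simp_all add: G)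
    then have "conjugate_in (RegAut p) G G"
      unfolding conjugate_in_def by (intro bexI [of _ ?one]) simp_all
    then show ?thesis using branch_rank_one assms(4) unfolding G by metis
  next
    case False
    then show ?thesis using branch_rank_ge_2 rE(1) unfolding G by simp
  qed
qed

end
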